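(* Let $0<p,q<\infty$, let $\omega$ be an admissible weight on $\mathbb{D}$ (with respect to the exponent $p$), and let $X=(X_n)_{n\ge 0}$ be a standard random sequence. Then $$(\mathcal{M}(p,q;\omega))_\star = H(2,q;\omega_{\mathrm r}).$$ That is, for $f(z)=\sum_{n\ge0}a_nz^n\in H(\mathbb{D})$, one has $\mathbb{P}(\mathcal{R}_Xf\in \mathcal{M}(p,q;\omega))=1$ if and only if $\int_0^1 M_2(f,s)^q\,d\omega_{\mathrm r}(s)<\infty$.
   Context: $\mathbb{D}$ is the open unit disk in $\mathbb{C}$, $H(\mathbb{D})$ the space of analytic functions on $\mathbb{D}$, and $dA=\frac1\pi r\,dr\,d\theta$ normalized area measure. A weight $\omega$ is a positive measurable function on $\mathbb{D}$ (not necessarily radial). Weighted Bergman space: for $0<p<\infty$, $A^p_\omega$ is the set of $f\in H(\mathbb{D})$ with $\|f\|=\left(\int_{\mathbb{D}}|f|^p\omega\,dA\right)^{1/p}<\infty$. Admissible weight (with respect to $p$): (1) finite mass: $\int_{\mathbb{D}}\omega\,dA<\infty$; (2) bounded point evaluations: for every $z\in\mathbb{D}$ the functional $L_z(f)=f(z)$ is continuous on $A^p_\omega$, and $\sup_{z\in K}\|L_z\|<\infty$ for each compact $K\subset\mathbb{D}$; (3) $\lim_{r\to1^-}\|f_r-f\|=0$ for every $f\in A^p_\omega$, where $f_r(z)=f(rz)$. Standard random sequence: a sequence $(X_n)_{n\ge0}$ of independent identically distributed random variables, which are all Bernoulli ($\pm1$ with probability $1/2$ each), or all Steinhaus (uniform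 on the unit circle), or all Gaussian $\mathcal{N}(0,1)$. For $f(z)=\sum_{n\ge 0} a_nz^n\in H(\mathbb{D})$, $(\mathcal{R}_Xf)(z)=\sum_{n\ge 0} a_nX_nz^n$. For a space $\mathcal{X}$ of analytic functions on $\mathbb{D}$, the random symbol space is $(\mathcal{X})_\star=\{f\in H(\mathbb{D}):\mathbb{P}(\mathcal{R}_Xf\in\mathcal{X})=1\}$. Radial-circular decomposition of $\omega$: $\overline{\omega}(s)=\frac1{2\pi}\int_0^{2\pi}\omega(se^{i\theta})\,d\theta$; the radial projection measure is $d\omega_{\mathrm r}(s)=\overline{\omega}(s)\,2s\,ds$ on $(0,1)$; the circular probability measures are $d\omega_{\mathrm c}(\theta;s)=\frac{\omega(se^{i\theta})}{\overline{\omega}(s)}\frac{d\theta}{2\pi}$ (for $\overline{\omega}(s)>0$). Non-radial mixed norm space: $\mathcal{M}(p,q;\omega)$ is the set of $f\in H(\mathbb{D})$ with $$\|f\|^q_{\mathcal{M}(p,q;\omega)}=\int_0^1\left(\int_0^{2\pi}|f(se^{i\theta})|^p\,d\omega_{\mathrm c}(\theta;s)\right)^{q/p}d\omega_{\mathrm r}(s)<\infty.$$ $M_p(f,r)=\left(\int_0^{2\pi}|f(re^{i\theta})|^p\frac{d\theta}{2\pi}\right)^{1/p}$, and $H(2,q;\omega_{\mathrm r})$ is the set of $f\in H(\mathbb{D})$ with $\int_0^1M_2(f,s)^q\,d\omega_{\mathrm r}(s)<\infty$. *)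

theory Defs
  imports "HOL-Probability.Probability"
begin

text \<open>
  Functions on the unit disc are total functions on the complex plane. None of the notions
  below depends on their values outside \<open>ball 0 1\<close>.
\<close>

definition disc_area :: "complex measure" where
  "disc_area = scale_measure (ennreal (1 / pi)) (lebesgue_on (ball 0 1))"

text \<open>
  Positivity of a weight is meant in the wide sense, so that the circular mean of a weight
  may vanish.
\<close>

definition weight :: "(complex \<Rightarrow> real) \<Rightarrow> bool" where
  "weight \<omega> \<longleftrightarrow>
     \<omega> \<in> borel_measurable (lebesgue_on (ball 0 1)) \<and> (\<forall>z\<in>ball 0 1. 0 \<le> \<omega> z)"

text \<open>The value at infinity is the right one only for positive exponents, the only ones used.\<close>

definition ennreal_powr :: "ennreal \<Rightarrow> real \<Rightarrow> ennreal" where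
  "ennreal_powr x a = (if x = \<infinity> then \<infinity> else ennreal (enn2real x powr a))"

definition bergman_norm :: "real \<Rightarrow> (complex \<Rightarrow> real) \<Rightarrow> (complex \<Rightarrow> complex) \<Rightarrow> ennreal" where
  "bergman_norm p \<omega> f =
     ennreal_powr (\<integral>\<^sup>+ z. ennreal (cmod (f z) powr p * \<omega> z) \<partial>disc_area) (1 / p)"

definition bergman_space :: "real \<Rightarrow> (complex \<Rightarrow> real) \<Rightarrow> (complex \<Rightarrow> complex) set" where
  "bergman_space p \<omega> = {f. f holomorphic_on ball 0 1 \<and> bergman_norm p \<omega> f < \<infinity>}"

text \<open>
  Continuity of a functional is spelled out with respect to the (quasi-)norm, because for
  \<open>p < 1\<close> the expression \<open>bergman_norm p \<omega> (f - g)\<close> is only a quasi-metric.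
\<close>

definition bergman_continuous ::
    "real \<Rightarrow> (complex \<Rightarrow> real) \<Rightarrow> ((complex \<Rightarrow> complex) \<Rightarrow> complex) \<Rightarrow> bool" where
  "bergman_continuous p \<omega> L \<longleftrightarrow>
     (\<forall>f\<in>bergman_space p \<omega>. \<forall>\<epsilon>>0. \<exists>\<delta>>0. \<forall>g\<in>bergman_space p \<omega>.
        bergman_norm p \<omega> (\<lambda>z. g z - f z) < ennreal \<delta> \<longrightarrow> cmod (L g - L f) < \<epsilon>)"

definition bergman_dual_norm ::
    "real \<Rightarrow> (complex \<Rightarrow> real) \<Rightarrow> ((complex \<Rightarrow> complex) \<Rightarrow> complex) \<Rightarrow> ennreal" where
  "bergman_dual_norm p \<omega> L =
     (SUP f\<in>{f \<in> bergman_space p \<omega>. bergman_norm p \<omega> f \<le> 1}. ennreal (cmod (L f)))"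

definition admissible_weight :: "real \<Rightarrow> (complex \<Rightarrow> real) \<Rightarrow> bool" where
  "admissible_weight p \<omega> \<longleftrightarrow>
     weight \<omega> \<and>
     (\<integral>\<^sup>+ z. ennreal (\<omega> z) \<partial>disc_area) < \<infinity> \<and>
     (\<forall>z\<in>ball 0 1. bergman_continuous p \<omega> (\<lambda>f. f z)) \<and>
     (\<forall>K. compact K \<and> K \<subseteq> ball 0 1 \<longrightarrow>
        (SUP z\<in>K. bergman_dual_norm p \<omega> (\<lambda>f. f z)) < \<infinity>) \<and>
     (\<forall>f\<in>bergman_space p \<omega>.
        ((\<lambda>r::real. bergman_norm p \<omega> (\<lambda>z. f (of_real r * z) - f z)) \<longlongrightarrow> 0) (at_left 1))"

definition bernoulli_law :: "complex measure" where
  "bernoulli_law = distr (measure_pmf (pmf_of_set {1, -1})) borel (\<lambda>x. x)"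

definition steinhaus_law :: "complex measure" where
  "steinhaus_law = distr (uniform_measure lborel {0..2 * pi}) borel cis"

text \<open>The real standard normal law, viewed as a law on the complex plane.\<close>

definition gaussian_law :: "complex measure" where
  "gaussian_law = distr (density lborel (\<lambda>x. ennreal (std_normal_density x))) borel complex_of_real"

definition standard_random_sequence :: "'a measure \<Rightarrow> (nat \<Rightarrow> 'a \<Rightarrow> complex) \<Rightarrow> bool" where
  "standard_random_sequence M X \<longleftrightarrow>
     prob_space.indep_vars M (\<lambda>_. borel) X UNIV \<and>
     (\<exists>law\<in>{bernoulli_law, steinhaus_law, gaussian_law}. \<forall>n. distr M borel (X n) = law)"

definition taylor_coeff :: "(complex \<Rightarrow> complex) \<Rightarrow> nat \<Rightarrow> complex" where
  "taylor_coeff f n = (deriv ^^ n) f 0 / fact n"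

text \<open>
  The randomised series belongs to a space only if it converges in the whole disc; this is
  required explicitly, since \<open>suminf\<close> has an arbitrary value on divergent series.
\<close>

definition random_symbol_space ::
    "'a measure \<Rightarrow> (nat \<Rightarrow> 'a \<Rightarrow> complex) \<Rightarrow> (complex \<Rightarrow> complex) set \<Rightarrow> (complex \<Rightarrow> complex) set" where
  "random_symbol_space M X S =
     {f. f holomorphic_on ball 0 1 \<and>
         (AE x in M.
            (\<forall>z\<in>ball 0 1. summable (\<lambda>n. taylor_coeff f n * X n x * z ^ n)) \<and>
            (\<lambda>z. \<Sum>n. taylor_coeff f n * X n x * z ^ n) \<in> S)}"

text \<open>
  Lebesgue (rather than Borel) measure is used for the radius and the angle: for a Lebesgue
  measurable weight the angular function is measurable only for almost every radius.
\<close>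

definition circular_mean :: "(complex \<Rightarrow> real) \<Rightarrow> real \<Rightarrow> ennreal" where
  "circular_mean \<omega> s =
     (\<integral>\<^sup>+ \<theta>. ennreal (\<omega> (of_real s * cis \<theta>)) \<partial>lebesgue_on {0..2 * pi}) / ennreal (2 * pi)"

definition radial_measure :: "(complex \<Rightarrow> real) \<Rightarrow> real measure" where
  "radial_measure \<omega> =
     density (lebesgue_on {0<..<1}) (\<lambda>s. circular_mean \<omega> s * ennreal (2 * s))"

text \<open>
  Only meaningful when \<open>circular_mean \<omega> s\<close> is positive and finite; for an integrable weight
  the remaining radii form a null set of \<open>radial_measure \<omega>\<close>.
\<close>

definition circular_measure :: "(complex \<Rightarrow> real) \<Rightarrow> real \<Rightarrow> real measure" where
  "circular_measure \<omega> s =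
     density (lebesgue_on {0..2 * pi})
       (\<lambda>\<theta>. ennreal (\<omega> (of_real s * cis \<theta>)) / circular_mean \<omega> s / ennreal (2 * pi))"

definition nonradial_mixed_norm_space ::
    "real \<Rightarrow> real \<Rightarrow> (complex \<Rightarrow> real) \<Rightarrow> (complex \<Rightarrow> complex) set" where
  "nonradial_mixed_norm_space p q \<omega> =
     {f. f holomorphic_on ball 0 1 \<and>
         (\<integral>\<^sup>+ s. ennreal_powr
            (\<integral>\<^sup>+ \<theta>. ennreal (cmod (f (of_real s * cis \<theta>)) powr p) \<partial>circular_measure \<omega> s) (q / p)
          \<partial>radial_measure \<omega>) < \<infinity>}"

definition integral_mean :: "real \<Rightarrow> (complex \<Rightarrow> complex) \<Rightarrow> real \<Rightarrow> ennreal" where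
  "integral_mean p f r =
     ennreal_powr
       ((\<integral>\<^sup>+ \<theta>. ennreal (cmod (f (of_real r * cis \<theta>)) powr p) \<partial>lebesgue_on {0..2 * pi}) / ennreal (2 * pi))
       (1 / p)"

definition mixed_norm_space :: "real \<Rightarrow> real \<Rightarrow> real measure \<Rightarrow> (complex \<Rightarrow> complex) set" where
  "mixed_norm_space p q \<mu> =
     {f. f holomorphic_on ball 0 1 \<and> (\<integral>\<^sup>+ s. ennreal_powr (integral_mean p f s) q \<partial>\<mu>) < \<infinity>}"

end

theory Submission
  imports Defs "HOL-Complex_Analysis.Complex_Analysis"
begin

text \<open>
  For a point \<open>z\<close> of modulus \<open>s\<close> the random variable \<open>R\<^sub>X f(z)\<close> is a subgaussian sum of
  variance \<open>M\<^sub>2(f, s)\<^sup>2\<close>, by Parseval. Its moments are therefore bounded by powers of \<open>M\<^sub>2(f, s)\<close>,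
  which by Jensen and Fubini bounds the expected mixed norm. Conversely, by Paley-Zygmund,
  \<open>|R\<^sub>X f(z)|\<close> exceeds a multiple of \<open>M\<^sub>2(f, s)\<close> with a probability bounded below, uniformly
  in \<open>z\<close>. If the mixed norm is almost surely finite, it is bounded on an event \<open>B\<close> of probability
  close to 1; on \<open>B\<close> the inner integral over the circle of radius \<open>s\<close> still has expectation at
  least a constant times \<open>M\<^sub>2(f, s)\<^sup>q\<close>, and integrating in \<open>s\<close> gives \<open>f \<in> H(2, q; \<omega>\<^sub>r)\<close>. The
  finite mass of \<open>\<omega>\<close> makes the circular means finite for almost every radius.
\<close>

section \<open>Real powers of extended nonnegative reals\<close>

text \<open>On the circle of radius \<open>s\<close> the coefficients of the random series have
  modulus \<open>|a_n| s^n\<close>, whatever the angle. The variance is therefore constant on the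
  circle, and averaging over it against any probability measure gives the same bounds; this is why
  only the radial projection of \<open>\<omega>\<close> survives in the answer. The three laws enter
  only through mean 0, variance 1 and the bound \<open>exp (|u|^2 / 2)\<close> on exponential
  moments, which controls every even moment of a sum with a constant free of the number of terms.
  The lower bound has to serve every ratio \<open>q / p\<close>, above or below 1, so it is run on
  the mass of the good angles, a quantity between 0 and 1, instead of on moments. The remaining
  obstacle is measurability: \<open>\<omega>\<close> is only Lebesgue measurable, and a single
  circle is a null set of the plane. A Borel version of \<open>\<omega>\<close> makes Tonelli
  available, and its agreement with \<open>\<omega>\<close> is carried over to almost every circle
  by a differentiable choice of polar coordinates.\<close>

lemma ennreal_powr_ennreal: "0 \<le> x \<Longrightarrow> ennreal_powr (ennreal x) a = ennreal (x powr a)"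
  by (simp add: ennreal_powr_def)

lemma ennreal_powr_mono: "0 < a \<Longrightarrow> x \<le> y \<Longrightarrow> ennreal_powr x a \<le> ennreal_powr y a"
  by (cases x; cases y) (auto simp: ennreal_powr_def top_unique intro!: ennreal_leI powr_mono2)

lemma ennreal_powr_mult:
  assumes "0 \<le> c"
  shows "ennreal_powr (ennreal c * x) a = ennreal (c powr a) * ennreal_powr x a"
proof (cases x)
  case (real r)
  then show ?thesis
    using assms by (simp add: ennreal_powr_ennreal powr_mult flip: ennreal_mult)
next
  case top
  then show ?thesis
    using assms by (cases "c = 0") (auto simp: ennreal_powr_def ennreal_mult_top)
qed

lemma ennreal_powr_powr: "ennreal_powr (ennreal_powr x a) b = ennreal_powr x (a * b)"
  by (cases x) (auto simp: ennreal_powr_def powr_powr)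

lemma borel_measurable_ennreal_powr [measurable (raw)]:
  assumes [measurable]: "f \<in> borel_measurable M"
  shows "(\<lambda>x. ennreal_powr (f x) a) \<in> borel_measurable M"
  unfolding ennreal_powr_def by measurable

text \<open>Jensen's inequality for the convex power \<open>r\<close>, with infinite values allowed.
  It comes from integrating the tangent line to \<open>t powr r\<close> at the mean
  \<open>a\<close>; that \<open>a\<close> is finite when the right side is follows from
  \<open>t \<le> 1 + t powr r\<close>.\<close>

lemma (in prob_space) ennreal_powr_nn_integral_le:
  fixes g :: "'a \<Rightarrow> real"
  assumes [measurable]: "g \<in> borel_measurable M" and g: "\<And>x. 0 \<le> g x" and r: "1 \<le> r"
  shows "ennreal_powr (\<integral>\<^sup>+ x. ennreal (g x) \<partial>M) r \<le> (\<integral>\<^sup>+ x. ennreal (g x powr r) \<partial>M)"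
proof (cases "(\<integral>\<^sup>+ x. ennreal (g x powr r) \<partial>M) = \<infinity>")
  case False
  have "(\<integral>\<^sup>+ x. ennreal (g x) \<partial>M) \<le> (\<integral>\<^sup>+ x. 1 + ennreal (g x powr r) \<partial>M)"
  proof (intro nn_integral_mono)
    fix x
    have "g x \<le> 1 + g x powr r"
    proof (cases "g x \<le> 1")
      case False
      then have "g x powr 1 \<le> g x powr r" using r by (intro powr_mono) auto
      then show ?thesis using False by simp
    qed (simp add: add_increasing2)
    then have "ennreal (g x) \<le> ennreal (1 + g x powr r)" by (rule ennreal_leI)
    then show "ennreal (g x) \<le> 1 + ennreal (g x powr r)" by simp
  qed
  also have "\<dots> = 1 + (\<integral>\<^sup>+ x. ennreal (g x powr r) \<partial>M)"
    by (subst nn_integral_add) (auto simp: emeasure_space_1)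
  also have "\<dots> < \<infinity>" using False by (simp add: less_top)
  finally obtain a where a: "(\<integral>\<^sup>+ x. ennreal (g x) \<partial>M) = ennreal a" "0 \<le> a"
    by (cases "(\<integral>\<^sup>+ x. ennreal (g x) \<partial>M)") auto
  show ?thesis
  proof (cases "a = 0")
    case True
    then show ?thesis by (simp add: a ennreal_powr_def)
  next
    case False
    with a have "0 < a" by simp
    obtain J where J: "(\<integral>\<^sup>+ x. ennreal (g x powr r) \<partial>M) = ennreal J" "0 \<le> J"
      using \<open>(\<integral>\<^sup>+ x. ennreal (g x powr r) \<partial>M) \<noteq> \<infinity>\<close>
        by (cases "(\<integral>\<^sup>+ x. ennreal (g x powr r) \<partial>M)") auto
    \<comment> \<open>Young's inequality for \<open>g x powr r\<close> and \<open>a powr r\<close>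
      with weights \<open>1 / r\<close> and \<open>1 - 1 / r\<close>, multiplied by
      \<open>r\<close>, is exactly the tangent line bound.\<close>
    have tangent: "r * a powr (r - 1) * g x \<le> g x powr r + (r - 1) * a powr r" for x
    proof (cases "g x = 0")
      case False
      then have "0 < g x" using g[of x] by simp
      have "(g x powr r) powr (1 / r) * (a powr r) powr (1 - 1 / r)
          \<le> (1 / r) * g x powr r + (1 - 1 / r) * a powr r"
        using \<open>0 < a\<close> \<open>0 < g x\<close> r by (intro Youngs_inequality_0) auto
      moreover have "r * (1 - 1 / r) = r - 1" using r by (simp add: field_simps)
      moreover have "r * ((1 / r) * g x powr r + (1 - 1 / r) * a powr r)
          = g x powr r + (r - 1) * a powr r"
        using r by (simp add: field_simps)
      ultimately show ?thesis
        using \<open>0 < g x\<close> r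
          mult_left_mono[of "(g x powr r) powr (1 / r) * (a powr r) powr (1 - 1 / r)" "(1 / r) * g x powr r + (1 - 1 / r) * a powr r" r]
        by (simp add: powr_powr right_diff_distrib mult_ac del: mult_le_cancel_left_pos)
    qed (use r in auto)
    have "ennreal (r * a powr (r - 1)) * ennreal a
        = (\<integral>\<^sup>+ x. ennreal (r * a powr (r - 1)) * ennreal (g x) \<partial>M)"
      by (subst nn_integral_cmult) (auto simp: a)
    also have "\<dots> \<le> (\<integral>\<^sup>+ x. ennreal (g x powr r) + ennreal ((r - 1) * a powr r) \<partial>M)"
      using r g tangent by (intro nn_integral_mono) (simp flip: ennreal_plus ennreal_mult)
    also have "\<dots> = ennreal J + ennreal ((r - 1) * a powr r)"
      by (subst nn_integral_add) (auto simp: emeasure_space_1 J)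
    finally have "r * a powr (r - 1) * a \<le> J + (r - 1) * a powr r"
      using a J r by (simp flip: ennreal_plus ennreal_mult)
    moreover have "a powr (r - 1) * a = a powr r"
      using \<open>0 < a\<close> by (simp add: powr_diff)
    ultimately have "r * a powr r \<le> J + (r - 1) * a powr r" by (simp add: mult.assoc)
    then have "a powr r \<le> J" by (simp add: left_diff_distrib)
    then show ?thesis using a J by (simp add: ennreal_powr_ennreal ennreal_leI)
  qed
qed simp

lemma powr_le_one_plus:
  assumes "0 \<le> (t::real)" "0 < a" "a \<le> 1"
  shows "t powr a \<le> 1 + t"
proof (cases "t \<le> 1")
  case True
  then have "t powr a \<le> 1" using assms by (intro powr_le1) auto
  then show ?thesis using assms by simp
next
  case False
  then have "t powr a \<le> t powr 1" using assms by (intro powr_mono) auto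
  then show ?thesis using False by simp
qed

text \<open>A crude substitute for Jensen with a concave power. It costs only a constant once the
  variable has been normalised to bounded mean.\<close>

lemma ennreal_powr_le_one_plus:
  assumes "0 < a" "a \<le> 1"
  shows "ennreal_powr x a \<le> 1 + x"
proof (cases x)
  case (real t)
  have "ennreal (t powr a) \<le> ennreal (1 + t)" using assms real
    by (intro ennreal_leI powr_le_one_plus) auto
  then show ?thesis using real by (simp add: ennreal_powr_ennreal)
qed simp

section \<open>Moments of subgaussian random series\<close>

lemma norm_le_square_plus: "norm z \<le> 1 + (norm z)\<^sup>2"
proof -
  have "0 \<le> (norm z - 1)\<^sup>2" by simp
  moreover have "(norm z - 1)\<^sup>2 = (norm z)\<^sup>2 - 2 * norm z + 1"
    by (simp add: power2_eq_square algebra_simps)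
  ultimately show ?thesis using norm_ge_zero[of z] by linarith
qed

text \<open>Each term of the exponential series at \<open>\<bar>y\<bar>\<close> is at most its sum,
  and \<open>exp \<bar>y\<bar>\<close> is one of the two exponentials on the right.\<close>

lemma power_even_le_exp: "(y::real) ^ (2 * k) \<le> fact (2 * k) * (exp y + exp (- y))"
proof -
  have *: "t ^ n \<le> fact n * exp t" if "0 \<le> t" for t :: real and n
  proof -
    have "(\<lambda>n. t ^ n /\<^sub>R fact n) sums exp t" by (rule exp_converges)
    then have "sum (\<lambda>n. t ^ n /\<^sub>R fact n) {n} \<le> exp t"
      using that sum_le_suminf[of "\<lambda>n. t ^ n /\<^sub>R fact n" "{n}"] by (auto simp: sums_iff)
    then show ?thesis by (simp add: field_simps)
  qed
  have "y ^ (2 * k) = \<bar>y\<bar> ^ (2 * k)" by (simp add: power_even_abs)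
  also have "\<dots> \<le> fact (2 * k) * exp \<bar>y\<bar>" by (rule *) simp
  also have "\<dots> \<le> fact (2 * k) * (exp y + exp (- y))" by (intro mult_left_mono) (auto simp: abs_if)
  finally show ?thesis .
qed

text \<open>The larger of the two coordinates carries at least half of the squared modulus, whence
  the factor \<open>2 ^ k\<close>. The four exponentials are \<open>exp (Re (u * z))\<close> for the
  unimodular \<open>u\<close> in 1, -1, -\<i>, \<i>, so that a bound on exponential moments in every
  complex direction applies to each.\<close>

lemma power_cmod_le_exp:
  "cmod z ^ (2 * k) \<le> 2 ^ k * fact (2 * k) *
    (exp (Re z) + exp (Re (- z)) + exp (Re (- \<i> * z)) + exp (Re (\<i> * z)))"
proof -
  define a b where "a = (Re z)\<^sup>2" and "b = (Im z)\<^sup>2"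
  have ab: "0 \<le> a" "0 \<le> b" by (auto simp: a_def b_def)
  have "cmod z ^ (2 * k) = (a + b) ^ k"
    by (simp add: power_mult cmod_power2 a_def b_def)
  also have "\<dots> \<le> (2 * max a b) ^ k"
    using ab by (intro power_mono) auto
  also have "\<dots> = 2 ^ k * max a b ^ k" by (simp add: power_mult_distrib)
  also have "\<dots> \<le> 2 ^ k * (a ^ k + b ^ k)"
    using ab by (intro mult_left_mono) (auto simp: max_def)
  also have "a ^ k + b ^ k = Re z ^ (2 * k) + Im z ^ (2 * k)"
    by (simp add: a_def b_def power_mult)
  also have "2 ^ k * (Re z ^ (2 * k) + Im z ^ (2 * k))
      \<le> 2 ^ k * (fact (2 * k) * (exp (Re z) + exp (- Re z)) + fact (2 * k) * (exp (Im z) + exp (- Im z)))"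
    by (intro mult_left_mono add_mono power_even_le_exp) auto
  finally show ?thesis by (simp add: algebra_simps)
qed

text \<open>The factor \<open>2 ^ k * fact (2 * k)\<close> is that of the pointwise exponential
  bound; the rest is four exponential moments, each at most \<open>exp (1 / 2)\<close> at unit
  variance.\<close>

definition moment_const :: "nat \<Rightarrow> real" where
  "moment_const k = 2 ^ k * fact (2 * k) * (4 * exp (1 / 2))"

lemma moment_const_pos: "0 < moment_const k"
  by (simp add: moment_const_def)

text \<open>The Paley-Zygmund bound \<open>(1 - 1/2)^2 (E Z)^2 / E (Z^2)\<close> for the squared
  modulus \<open>Z\<close> of a random sum, when \<open>E (Z^2)\<close> is at most
  \<open>moment_const 2\<close> times \<open>(E Z)^2\<close>.\<close>

definition pz_const :: real where "pz_const = 1 / (4 * moment_const 2)"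

lemma pz_const_pos: "0 < pz_const"
  by (simp add: pz_const_def moment_const_pos)

text \<open>Expand the square and integrate term by term. Only orthonormality is assumed, so that
  the same lemma serves the random variables \<open>X n\<close> and, in Parseval's identity, the
  characters \<open>cis \<theta> ^ n\<close>.\<close>

lemma (in prob_space) second_moment_orthonormal:
  fixes X :: "'i \<Rightarrow> 'a \<Rightarrow> complex"
  assumes "finite I"
    and integrable_pair: "\<And>m n. integrable M (\<lambda>x. X m x * cnj (X n x))"
    and expectation_pair: "\<And>m n. expectation (\<lambda>x. X m x * cnj (X n x)) = (if m = n then 1 else 0)"
  shows "integrable M (\<lambda>x. (cmod (\<Sum>n\<in>I. b n * X n x))\<^sup>2)"
    and "expectation (\<lambda>x. (cmod (\<Sum>n\<in>I. b n * X n x))\<^sup>2) = (\<Sum>n\<in>I. (cmod (b n))\<^sup>2)"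
proof -
  have eq: "complex_of_real ((cmod (\<Sum>n\<in>I. b n * X n x))\<^sup>2)
      = (\<Sum>m\<in>I. \<Sum>n\<in>I. b m * cnj (b n) * (X m x * cnj (X n x)))" for x
    by (simp add: complex_norm_square sum_product mult_ac del: of_real_power)
  have int: "integrable M (\<lambda>x. complex_of_real ((cmod (\<Sum>n\<in>I. b n * X n x))\<^sup>2))"
    unfolding eq by (intro Bochner_Integration.integrable_sum integrable_mult_right integrable_pair)
  then show "integrable M (\<lambda>x. (cmod (\<Sum>n\<in>I. b n * X n x))\<^sup>2)"
    by (simp only: complex_of_real_integrable_eq)
  have "complex_of_real (expectation (\<lambda>x. (cmod (\<Sum>n\<in>I. b n * X n x))\<^sup>2))
      = expectation (\<lambda>x. \<Sum>m\<in>I. \<Sum>n\<in>I. b m * cnj (b n) * (X m x * cnj (X n x)))"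
    unfolding eq[symmetric] by (simp only: integral_complex_of_real)
  also have "\<dots> = (\<Sum>m\<in>I. \<Sum>n\<in>I. b m * cnj (b n) * (if m = n then 1 else 0))"
    by (subst Bochner_Integration.integral_sum | intro sum.cong refl Bochner_Integration.integrable_sum integrable_mult_right integrable_pair | simp only: integral_mult_right_zero expectation_pair)+
  also have "\<dots> = (\<Sum>m\<in>I. b m * cnj (b m))"
    using assms by (intro sum.cong refl) (simp add: if_distrib cong: if_cong)
  also have "\<dots> = of_real (\<Sum>n\<in>I. (cmod (b n))\<^sup>2)"
    by (simp add: complex_norm_square del: of_real_power)
  finally show "expectation (\<lambda>x. (cmod (\<Sum>n\<in>I. b n * X n x))\<^sup>2) = (\<Sum>n\<in>I. (cmod (b n))\<^sup>2)"
    by (simp only: of_real_eq_iff)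
qed

lemma summable_square_norm:
  fixes b :: "nat \<Rightarrow> complex"
  assumes "summable (\<lambda>n. cmod (b n))"
  shows "summable (\<lambda>n. (cmod (b n))\<^sup>2)"
proof (rule summable_comparison_test_ev[OF _ assms])
  have "eventually (\<lambda>n. cmod (b n) < 1) sequentially"
    using summable_LIMSEQ_zero[OF assms] by (rule order_tendstoD) simp
  then show "eventually (\<lambda>n. norm ((cmod (b n))\<^sup>2) \<le> cmod (b n)) sequentially"
    by eventually_elim (simp add: power2_eq_square mult_left_le)
qed

text \<open>What the Bernoulli, Steinhaus and Gaussian sequences have in common. The exponential
  moment is bounded for every complex \<open>u\<close>, which controls all real-linear functionals
  of \<open>X n\<close> and hence both its real and its imaginary part.\<close>

locale subgaussian_sequence = prob_space M for M :: "'a measure" +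
  fixes X :: "nat \<Rightarrow> 'a \<Rightarrow> complex"
  assumes indep: "indep_vars (\<lambda>_. borel) X UNIV"
    and mgf: "\<And>n u. (\<integral>\<^sup>+ x. ennreal (exp (Re (u * X n x))) \<partial>M) \<le> ennreal (exp ((cmod u)\<^sup>2 / 2))"
    and mean: "\<And>n. expectation (X n) = 0"
    and variance: "\<And>n. expectation (\<lambda>x. (cmod (X n x))\<^sup>2) = 1"
begin

lemma measurable_X [measurable]: "X n \<in> borel_measurable M"
  using indep by (auto simp: indep_vars_def)

text \<open>The Bochner integral of a non-integrable function is 0, so the value 1 forces
  integrability.\<close>

lemma integrable_square: "integrable M (\<lambda>x. (cmod (X n x))\<^sup>2)"
  using variance[of n] by (metis not_integrable_integral_eq zero_neq_one)

lemma integrable_X: "integrable M (X n)"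
proof (rule Bochner_Integration.integrable_bound)
  show "integrable M (\<lambda>x. 1 + (cmod (X n x))\<^sup>2)"
    using integrable_square by simp
  show "AE x in M. norm (X n x) \<le> norm (1 + (cmod (X n x))\<^sup>2)"
    using norm_le_square_plus by (intro AE_I2) (auto intro: order_trans)
qed simp

lemma expectation_norm_le: "expectation (\<lambda>x. cmod (X n x)) \<le> 2"
proof -
  have "expectation (\<lambda>x. cmod (X n x)) \<le> expectation (\<lambda>x. 1 + (cmod (X n x))\<^sup>2)"
    by (intro integral_mono norm_le_square_plus) (auto intro: integrable_X integrable_square)
  also have "\<dots> = 2"
    using integrable_square[of n] variance[of n] by (simp add: prob_space)
  finally show ?thesis .
qed

lemma mgf_sum:
  assumes "finite I"
  shows "(\<integral>\<^sup>+ x. ennreal (exp (Re (\<Sum>n\<in>I. b n * X n x))) \<partial>M)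
      \<le> ennreal (exp ((\<Sum>n\<in>I. (cmod (b n))\<^sup>2) / 2))"
proof -
  have ind: "indep_vars (\<lambda>_. borel) (\<lambda>n x. ennreal (exp (Re (b n * X n x)))) I"
    by (rule indep_vars_compose2[OF indep_vars_subset[OF indep]]) auto
  have "(\<integral>\<^sup>+ x. ennreal (exp (Re (\<Sum>n\<in>I. b n * X n x))) \<partial>M)
      = (\<integral>\<^sup>+ x. (\<Prod>n\<in>I. ennreal (exp (Re (b n * X n x)))) \<partial>M)"
    by (simp add: prod_ennreal exp_sum assms del: times_complex.sel)
  also have "\<dots> = (\<Prod>n\<in>I. \<integral>\<^sup>+ x. ennreal (exp (Re (b n * X n x))) \<partial>M)"
    by (rule indep_vars_nn_integral[OF assms ind]) auto
  also have "\<dots> \<le> (\<Prod>n\<in>I. ennreal (exp ((cmod (b n))\<^sup>2 / 2)))"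
    using assms by (intro prod_mono_ennreal mgf)
  also have "\<dots> = ennreal (exp ((\<Sum>n\<in>I. (cmod (b n))\<^sup>2) / 2))"
    by (simp add: prod_ennreal exp_sum assms sum_divide_distrib)
  finally show ?thesis .
qed


text \<open>Both sides are homogeneous of degree \<open>2 * k\<close> in \<open>b\<close>, so the
  sum is first normalised to unit variance. Without this the exponential moments would give a bound
  exponential in the variance instead of its \<open>k\<close>-th power. Vanishing variance is
  treated apart, since it cannot be normalised.\<close>

lemma moment_finite_sum:
  assumes I: "finite I"
  shows "(\<integral>\<^sup>+ x. ennreal (cmod (\<Sum>n\<in>I. b n * X n x) ^ (2 * k)) \<partial>M)
    \<le> ennreal (moment_const k * (\<Sum>n\<in>I. (cmod (b n))\<^sup>2) ^ k)"
proof -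
  define V where "V = sqrt (\<Sum>n\<in>I. (cmod (b n))\<^sup>2)"
  have V2: "V\<^sup>2 = (\<Sum>n\<in>I. (cmod (b n))\<^sup>2)" by (simp add: V_def sum_nonneg)
  have *: "(\<integral>\<^sup>+ x. ennreal (cmod (\<Sum>n\<in>I. c n * X n x) ^ (2 * k)) \<partial>M) \<le> ennreal (moment_const k)"
    if c: "(\<Sum>n\<in>I. (cmod (c n))\<^sup>2) = 1" for c
  proof -
    define S where "S x = (\<Sum>n\<in>I. c n * X n x)" for x
    have [measurable]: "S \<in> borel_measurable M" unfolding S_def by measurable
    have E: "(\<integral>\<^sup>+ x. ennreal (exp (Re (u * S x))) \<partial>M) \<le> ennreal (exp (1/2))" if "cmod u = 1" for u
      using mgf_sum[OF I, of "\<lambda>n. u * c n"] that c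
      by (simp add: S_def sum_distrib_left norm_mult mult.assoc del: times_complex.sel)
    have "(\<integral>\<^sup>+ x. ennreal (cmod (S x) ^ (2 * k)) \<partial>M) \<le>
      (\<integral>\<^sup>+ x. ennreal (2 ^ k * fact (2 * k)) * (ennreal (exp (Re (1 * S x))) + ennreal (exp (Re ((-1) * S x)))
        + ennreal (exp (Re (- \<i> * S x))) + ennreal (exp (Re (\<i> * S x)))) \<partial>M)"
      by (intro nn_integral_mono order_trans[OF ennreal_leI[OF power_cmod_le_exp]])
        (simp flip: ennreal_plus ennreal_mult)
    also have "\<dots>
        = ennreal (2 ^ k * fact (2 * k)) * ((\<integral>\<^sup>+ x. ennreal (exp (Re (1 * S x))) \<partial>M) + (\<integral>\<^sup>+ x. ennreal (exp (Re ((-1) * S x))) \<partial>M)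
        + (\<integral>\<^sup>+ x. ennreal (exp (Re (- \<i> * S x))) \<partial>M) + (\<integral>\<^sup>+ x. ennreal (exp (Re (\<i> * S x))) \<partial>M))"
      by (subst nn_integral_cmult, measurable, (subst nn_integral_add, measurable)+)
    also have "\<dots>
        \<le> ennreal (2 ^ k * fact (2 * k)) * (ennreal (exp (1/2)) + ennreal (exp (1/2)) + ennreal (exp (1/2)) + ennreal (exp (1/2)))"
      by (intro mult_left_mono add_mono E) auto
    also have "\<dots> = ennreal (moment_const k)"
      by (simp add: moment_const_def flip: ennreal_plus ennreal_mult)
    finally show ?thesis by (simp add: S_def)
  qed
  show ?thesis
  proof (cases "V = 0")
    case True
    then have "\<forall>n\<in>I. b n = 0" using V2 I by (simp add: sum_nonneg_eq_0_iff)
    then show ?thesis using V2 True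
      by (cases "k = 0")
        (auto simp: emeasure_space_1 moment_const_def zero_power
          intro!: mult_ge1_I fact_ge_1 one_le_power)
  next
    case False
    then have "0 < V" by (simp add: V_def sum_nonneg less_le)
    have "(\<Sum>n\<in>I. (cmod (b n / V))\<^sup>2) = 1"
      using \<open>0 < V\<close> by (simp add: norm_divide power_divide flip: sum_divide_distrib V2)
    from *[OF this] have "ennreal (V ^ (2 * k)) * (\<integral>\<^sup>+ x. ennreal (cmod (\<Sum>n\<in>I. b n / V * X n x) ^ (2 * k)) \<partial>M)
        \<le> ennreal (V ^ (2 * k)) * ennreal (moment_const k)"
      by (intro mult_left_mono) auto
    also have "ennreal (V ^ (2 * k)) * (\<integral>\<^sup>+ x. ennreal (cmod (\<Sum>n\<in>I. b n / V * X n x) ^ (2 * k)) \<partial>M)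
        = (\<integral>\<^sup>+ x. ennreal (cmod (\<Sum>n\<in>I. b n * X n x) ^ (2 * k)) \<partial>M)"
      using \<open>0 < V\<close>
      by (subst nn_integral_cmult[symmetric])
         (auto simp: norm_divide power_divide simp flip: ennreal_mult sum_divide_distrib intro!: nn_integral_cong)
    finally show ?thesis
      using \<open>0 < V\<close> moment_const_pos[of k] unfolding power_mult V2
      by (simp add: mult.commute sum_nonneg flip: ennreal_mult)
  qed
qed

text \<open>Off the diagonal the expectation factors by independence and each factor has mean 0; on
  the diagonal it is the variance.\<close>

lemma integrable_pair: "integrable M (\<lambda>x. X m x * cnj (X n x))"
  and expectation_pair: "expectation (\<lambda>x. X m x * cnj (X n x)) = (if m = n then 1 else 0)"
proof -
  have "integrable M (\<lambda>x. X m x * cnj (X n x)) \<and>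
      expectation (\<lambda>x. X m x * cnj (X n x)) = (if m = n then 1 else 0)"
  proof (cases "m = n")
    case True
    have "(\<lambda>x. X n x * cnj (X n x)) = (\<lambda>x. of_real ((cmod (X n x))\<^sup>2))"
      by (rule ext) (simp only: complex_norm_square)
    then show ?thesis
      using True integrable_square[of n] variance[of n]
        by (simp only: integrable_of_real integral_complex_of_real) simp
  next
    case False
    \<comment> \<open>Conjugating only the factor with index \<open>n\<close> makes the product of
      \<open>Y\<close> over \<open>{m, n}\<close> the required pair, in the form that the product
      rule for independent families expects.\<close>
    define Y where "Y i = (if i = n then (\<lambda>x. cnj (X i x)) else X i)" for i
    have "indep_vars (\<lambda>_. borel) (\<lambda>i x. (if i = n then cnj else id) (X i x)) {m, n}"
      by (rule indep_vars_compose2[OF indep_vars_subset[OF indep]])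
        (auto intro!: borel_measurable_continuous_onI continuous_intros)
    then have ind: "indep_vars (\<lambda>_. borel) Y {m, n}"
      by (rule iffD1[OF indep_vars_cong, rotated -1]) (auto simp: Y_def)
    have int: "integrable M (Y i)" for i using integrable_X by (simp add: Y_def)
    show ?thesis
      using indep_vars_integrable[OF _ ind int] indep_vars_lebesgue_integral[OF _ ind int] False mean[of m]
      by (simp add: Y_def)
  qed
  then show "integrable M (\<lambda>x. X m x * cnj (X n x))"
    "expectation (\<lambda>x. X m x * cnj (X n x)) = (if m = n then 1 else 0)" by auto
qed

lemmas second_moment_finite_sum = second_moment_orthonormal[OF _ integrable_pair expectation_pair]

text \<open>The second moment is exactly \<open>V\<close> and the fourth at most
  \<open>C * V\<^sup>2\<close>. A weighted AM-GM inequality takes the role of Cauchy-Schwarz: with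
  the weight \<open>4 * C * V\<close> the fourth moment costs \<open>V / 4\<close>, the complement
  of \<open>A\<close> costs \<open>V / 2\<close>, and the remaining \<open>V / 4\<close> is at most
  \<open>C * V * prob A\<close>.\<close>

lemma paley_zygmund_finite_sum:
  assumes I: "finite I"
  shows "pz_const \<le> prob {x \<in> space M. (\<Sum>n\<in>I. (cmod (b n))\<^sup>2) / 2 \<le> (cmod (\<Sum>n\<in>I. b n * X n x))\<^sup>2}"
proof -
  define V where "V = (\<Sum>n\<in>I. (cmod (b n))\<^sup>2)"
  define S where "S x = (\<Sum>n\<in>I. b n * X n x)" for x
  define A where "A = {x \<in> space M. V / 2 \<le> (cmod (S x))\<^sup>2}"
  have [measurable]: "S \<in> borel_measurable M" unfolding S_def by measurable
  have A [measurable]: "A \<in> events" unfolding A_def by measurable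
  define C where "C = moment_const 2"
  have "0 < C" by (simp add: C_def moment_const_pos)
  \<comment> \<open>This settles the case \<open>V = 0\<close>, where \<open>A\<close> is the whole
    space and \<open>1 / (4 * C)\<close> has to be at most 1.\<close>
  have "1 \<le> C"
    using one_le_exp_iff[of "1 / 2 :: real"] by (simp add: C_def moment_const_def fact_numeral del: one_le_exp_iff)
  have "0 \<le> V" by (simp add: V_def sum_nonneg)
  have "pz_const \<le> prob A"
  proof (cases "V = 0")
    case True
    then have "A = space M" by (auto simp: A_def)
    then show ?thesis using \<open>1 \<le> C\<close> by (simp add: prob_space pz_const_def flip: C_def)
  next
    case False
    with \<open>0 \<le> V\<close> have "0 < V" by simp
    have le4: "(\<integral>\<^sup>+ x. ennreal (cmod (S x) ^ 4) \<partial>M) \<le> ennreal (C * V\<^sup>2)"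
      using moment_finite_sum[OF I, of b 2] by (simp add: V_def S_def C_def)
    then have int4: "integrable M (\<lambda>x. cmod (S x) ^ 4)"
      by (intro integrableI_nonneg) (auto simp: less_top[symmetric] top_unique)
    have E4: "expectation (\<lambda>x. cmod (S x) ^ 4) \<le> C * V\<^sup>2"
      using le4 \<open>0 < C\<close> by (subst (asm) nn_integral_eq_integral[OF int4])
        (auto simp: ennreal_le_iff)
    have int2: "integrable M (\<lambda>x. (cmod (S x))\<^sup>2)" and E2: "expectation (\<lambda>x. (cmod (S x))\<^sup>2) = V"
      using second_moment_finite_sum[OF I, of b] by (auto simp: S_def V_def)
    \<comment> \<open>AM-GM on \<open>A\<close>: \<open>t \<le> t\<^sup>2 / (4 C V) + C V\<close>, and \<open>t \<le> V / 2\<close> off \<open>A\<close>.\<close>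
    have pt: "(cmod (S x))\<^sup>2
        \<le> V / 2 + cmod (S x) ^ 4 / (4 * C * V) + C * V * indicator A x" if "x \<in> space M" for x
    proof (cases "x \<in> A")
      case True
      define t where "t = (cmod (S x))\<^sup>2"
      have t4: "cmod (S x) ^ 4 = t\<^sup>2" by (simp add: t_def flip: power_mult)
      have "0 \<le> (t - 2 * (C * V))\<^sup>2" by simp
      then have "t * (4 * C * V) \<le> t\<^sup>2 + C * V * (4 * C * V)"
        by (simp add: power2_eq_square algebra_simps)
      then have "t \<le> t\<^sup>2 / (4 * C * V) + C * V"
        using \<open>0 < C\<close> \<open>0 < V\<close> by (simp add: field_simps)
      then show ?thesis using True \<open>0 < V\<close> by (simp add: t4 flip: t_def)
    next
      case False
      then have "(cmod (S x))\<^sup>2 \<le> V / 2" using that by (simp add: A_def)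
      moreover have "0 \<le> cmod (S x) ^ 4 / (4 * C * V)" using \<open>0 < C\<close> \<open>0 < V\<close> by simp
      ultimately show ?thesis using False by simp
    qed
    have "V \<le> expectation (\<lambda>x. V / 2 + cmod (S x) ^ 4 / (4 * C * V) + C * V * indicator A x)"
      unfolding E2[symmetric]
        by (intro integral_mono int2 pt[unfolded E2[symmetric]] Bochner_Integration.integrable_add)
          (auto intro: int4 simp: integrable_indicator_iff less_top[symmetric])
    also have "\<dots> = V / 2 + expectation (\<lambda>x. cmod (S x) ^ 4) / (4 * C * V) + C * V * prob A"
      by (subst Bochner_Integration.integral_add Bochner_Integration.integrable_add | simp add: prob_space int4 less_top[symmetric])+
    also have "\<dots> \<le> V / 2 + V / 4 + C * V * prob A"
      using E4 \<open>0 < C\<close> \<open>0 < V\<close> by (simp add: field_simps power2_eq_square)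
    finally have "V * (1 / 4) \<le> V * (C * prob A)" by (simp add: algebra_simps)
    then have "1 / 4 \<le> C * prob A" using \<open>0 < V\<close> by (simp only: mult_le_cancel_left_pos)
    then show ?thesis using \<open>0 < C\<close> by (simp add: pz_const_def field_simps flip: C_def)
  qed
  then show ?thesis by (simp add: A_def V_def S_def)
qed

text \<open>The first absolute moments of the \<open>X n\<close> are at most 2, so by Tonelli the
  series of absolute values has finite expectation.\<close>

lemma AE_summable:
  assumes "summable (\<lambda>n. cmod (b n))"
  shows "AE x in M. summable (\<lambda>n. b n * X n x)"
proof -
  have "(\<integral>\<^sup>+ x. (\<Sum>n. ennreal (cmod (b n * X n x))) \<partial>M)
      = (\<Sum>n. \<integral>\<^sup>+ x. ennreal (cmod (b n * X n x)) \<partial>M)"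
    by (rule nn_integral_suminf) measurable
  also have "\<dots> \<le> (\<Sum>n. ennreal (cmod (b n) * 2))"
  proof (intro suminf_le allI)
    fix n
    have "(\<integral>\<^sup>+ x. ennreal (cmod (b n * X n x)) \<partial>M)
        = ennreal (cmod (b n) * expectation (\<lambda>x. cmod (X n x)))"
      by (subst nn_integral_eq_integral) (auto simp: norm_mult integrable_X)
    also have "\<dots> \<le> ennreal (cmod (b n) * 2)"
      by (intro ennreal_leI mult_left_mono expectation_norm_le) auto
    finally show "(\<integral>\<^sup>+ x. ennreal (cmod (b n * X n x)) \<partial>M) \<le> ennreal (cmod (b n) * 2)" .
  qed auto
  also have "\<dots> = ennreal (\<Sum>n. cmod (b n) * 2)"
    by (rule suminf_ennreal2) (auto intro: summable_mult2 assms)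
  also have "\<dots> < \<infinity>" by simp
  finally have "AE x in M. (\<Sum>n. ennreal (cmod (b n * X n x))) \<noteq> \<infinity>"
    by (intro nn_integral_PInf_AE) auto
  then show ?thesis
  proof eventually_elim
    case (elim x)
    then have "summable (\<lambda>n. cmod (b n * X n x))"
      by (intro summable_suminf_not_top) auto
    then show ?case by (rule summable_norm_cancel)
  qed
qed

text \<open>Fatou's lemma, applied to the partial sums, whose moment bounds increase to the one
  claimed.\<close>

lemma moment_suminf:
  assumes b: "summable (\<lambda>n. cmod (b n))"
  shows "(\<integral>\<^sup>+ x. ennreal (cmod (\<Sum>n. b n * X n x) ^ (2 * k)) \<partial>M)
    \<le> ennreal (moment_const k * (\<Sum>n. (cmod (b n))\<^sup>2) ^ k)"
proof -
  note s2 = summable_square_norm[OF b]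
  have "(\<integral>\<^sup>+ x. ennreal (cmod (\<Sum>n. b n * X n x) ^ (2 * k)) \<partial>M)
      = (\<integral>\<^sup>+ x. liminf (\<lambda>N. ennreal (cmod (\<Sum>n<N. b n * X n x) ^ (2 * k))) \<partial>M)"
  proof (rule nn_integral_cong_AE, use AE_summable[OF b] in eventually_elim)
    case (elim x)
    have "(\<lambda>N. ennreal (cmod (\<Sum>n<N. b n * X n x) ^ (2 * k))) \<longlonglongrightarrow> ennreal (cmod (\<Sum>n. b n * X n x) ^ (2 * k))"
      by (intro tendsto_intros tendsto_ennrealI summable_LIMSEQ elim)
    then show ?case by (intro lim_imp_Liminf[symmetric]) auto
  qed
  also have "\<dots> \<le> liminf (\<lambda>N. \<integral>\<^sup>+ x. ennreal (cmod (\<Sum>n<N. b n * X n x) ^ (2 * k)) \<partial>M)"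
    by (rule nn_integral_liminf) measurable
  also have "\<dots> \<le> ennreal (moment_const k * (\<Sum>n. (cmod (b n))\<^sup>2) ^ k)"
  proof (intro Liminf_le eventuallyI)
    fix N
    have "(\<integral>\<^sup>+ x. ennreal (cmod (\<Sum>n<N. b n * X n x) ^ (2 * k)) \<partial>M)
        \<le> ennreal (moment_const k * (\<Sum>n<N. (cmod (b n))\<^sup>2) ^ k)"
      by (rule moment_finite_sum) simp
    also have "\<dots> \<le> ennreal (moment_const k * (\<Sum>n. (cmod (b n))\<^sup>2) ^ k)"
      using moment_const_pos[of k]
      by (intro ennreal_leI mult_left_mono power_mono sum_le_suminf s2 sum_nonneg) auto
    finally show "(\<integral>\<^sup>+ x. ennreal (cmod (\<Sum>n<N. b n * X n x) ^ (2 * k)) \<partial>M)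
        \<le> ennreal (moment_const k * (\<Sum>n. (cmod (b n))\<^sup>2) ^ k)" .
  qed simp
  finally show ?thesis .
qed

text \<open>Each partial sum has its own good event \<open>A N\<close>. The event that infinitely
  many of them occur has probability at least \<open>pz_const\<close>, by continuity from above, and
  on it the closed inequality passes to the limit.\<close>

lemma paley_zygmund_suminf:
  assumes b: "summable (\<lambda>n. cmod (b n))"
  shows "pz_const \<le> prob {x \<in> space M. (\<Sum>n. (cmod (b n))\<^sup>2) / 2 \<le> (cmod (\<Sum>n. b n * X n x))\<^sup>2}"
proof -
  note s2 = summable_square_norm[OF b]
  define A where "A N = {x \<in> space M. (\<Sum>n<N. (cmod (b n))\<^sup>2) / 2 \<le> (cmod (\<Sum>n<N. b n * X n x))\<^sup>2}" for N
  define B where "B N = (\<Union>k\<in>{N..}. A k)" for N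
  have [measurable]: "A N \<in> events" for N unfolding A_def by measurable
  have [measurable]: "B N \<in> events" for N unfolding B_def by measurable
  have lim: "(\<lambda>N. prob (B N)) \<longlonglongrightarrow> prob (\<Inter>N. B N)"
    by (rule finite_Lim_measure_decseq) (auto simp: decseq_def B_def intro: order_trans)
  have "pz_const \<le> prob (B N)" for N
  proof -
    have "pz_const \<le> prob (A N)" unfolding A_def by (rule paley_zygmund_finite_sum) simp
    also have "\<dots> \<le> prob (B N)" by (rule finite_measure_mono) (auto simp: B_def)
    finally show ?thesis .
  qed
  then have "pz_const \<le> prob (\<Inter>N. B N)" by (intro LIMSEQ_le_const[OF lim]) auto
  also have "\<dots> \<le> prob {x \<in> space M. (\<Sum>n. (cmod (b n))\<^sup>2) / 2 \<le> (cmod (\<Sum>n. b n * X n x))\<^sup>2}"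
  proof (rule finite_measure_mono_AE, use AE_summable[OF b] in eventually_elim)
    case (elim x)
    show ?case
    proof
      assume x: "x \<in> (\<Inter>N. B N)"
      then have sp: "x \<in> space M" by (auto simp: B_def A_def)
      have fr: "\<exists>k\<ge>N. (\<Sum>n<k. (cmod (b n))\<^sup>2) / 2 \<le> (cmod (\<Sum>n<k. b n * X n x))\<^sup>2" for N
        using x by (auto simp: B_def A_def)
      have L: "(\<lambda>N. (cmod (\<Sum>n<N. b n * X n x))\<^sup>2 - (\<Sum>n<N. (cmod (b n))\<^sup>2) / 2)
          \<longlonglongrightarrow> (cmod (\<Sum>n. b n * X n x))\<^sup>2 - (\<Sum>n. (cmod (b n))\<^sup>2) / 2"
        by (intro tendsto_intros summable_LIMSEQ elim s2) auto
      have "0 \<le> (cmod (\<Sum>n. b n * X n x))\<^sup>2 - (\<Sum>n. (cmod (b n))\<^sup>2) / 2"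
      proof (rule ccontr)
        assume "\<not> ?thesis"
        then have "eventually (\<lambda>N. (cmod (\<Sum>n<N. b n * X n x))\<^sup>2 - (\<Sum>n<N. (cmod (b n))\<^sup>2) / 2 < 0) sequentially"
          by (intro order_tendstoD(2)[OF L]) simp
        then show False using fr by (force simp: eventually_sequentially)
      qed
      then show "x \<in> {x \<in> space M. (\<Sum>n. (cmod (b n))\<^sup>2) / 2 \<le> (cmod (\<Sum>n. b n * X n x))\<^sup>2}"
        using sp by simp
    qed
  qed measurable
  finally show ?thesis .
qed

section \<open>Mixed moments of random series over an arbitrary probability measure\<close>

context
  fixes N :: "'b measure" and b :: "'b \<Rightarrow> nat \<Rightarrow> complex" and \<beta> :: "nat \<Rightarrow> real"
  assumes N: "prob_space N"
    and b_measurable [measurable]: "\<And>n. (\<lambda>\<theta>. b \<theta> n) \<in> borel_measurable N"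
    and norm_b: "\<And>\<theta> n. cmod (b \<theta> n) = \<beta> n"
    and summable_\<beta>: "summable \<beta>"
begin

interpretation N: prob_space N by (rule N)
interpretation NM: pair_sigma_finite N M by unfold_locales

text \<open>Both exponents are dominated by one even integer \<open>2 * k\<close>, for which the
  moments are known. Jensen in \<theta> raises \<open>p\<close> to \<open>2 * k\<close>, and Tonelli
  bounds the expectation of the resulting \<open>J\<close> by a multiple of \<open>V ^ k\<close>.
  The outer power \<open>q / m\<close> is then at most 1.\<close>

lemma mixed_moment_upper:
  assumes "0 < p" "0 < q" "p \<le> 2 * real k" "q \<le> 2 * real k"
  shows "(\<integral>\<^sup>+ x. ennreal_powr (\<integral>\<^sup>+ \<theta>. ennreal (cmod (\<Sum>n. b \<theta> n * X n x) powr p) \<partial>N) (q / p) \<partial>M)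
    \<le> ennreal ((1 + moment_const k) * (\<Sum>n. (\<beta> n)\<^sup>2) powr (q / 2))"
proof -
  define V where "V = (\<Sum>n. (\<beta> n)\<^sup>2)"
  define S where "S \<theta> x = (\<Sum>n. b \<theta> n * X n x)" for \<theta> x
  define m where "m = 2 * real k"
  have m: "0 < m" "p \<le> m" "q \<le> m" "0 < k" using assms by (auto simp: m_def)
  have [measurable]: "case_prod S \<in> borel_measurable (N \<Otimes>\<^sub>M M)"
    unfolding S_def case_prod_beta by measurable
  have [measurable]: "(\<lambda>x. S (f x) (g x)) \<in> borel_measurable L"
    if "f \<in> L \<rightarrow>\<^sub>M N" "g \<in> L \<rightarrow>\<^sub>M M" for f g and L :: "'c measure"
    using measurable_compose[OF measurable_Pair[OF that] \<open>case_prod S \<in> borel_measurable (N \<Otimes>\<^sub>M M)\<close>] by simp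
  have \<beta>0: "0 \<le> \<beta> n" for n using norm_b[of undefined n] norm_ge_zero by metis
  have sb: "summable (\<lambda>n. cmod (b \<theta> n))" for \<theta> using summable_\<beta> by (simp add: norm_b)
  have s2: "summable (\<lambda>n. (\<beta> n)\<^sup>2)" using summable_square_norm[OF sb] by (simp add: norm_b)
  have "0 \<le> V" unfolding V_def by (intro suminf_nonneg s2) auto
  define J where "J x = (\<integral>\<^sup>+ \<theta>. ennreal (cmod (S \<theta> x) ^ (2 * k)) \<partial>N)" for x
  have [measurable]: "J \<in> borel_measurable M" unfolding J_def by measurable
  \<comment> \<open>At \<open>z = 0\<close> this relies on \<open>0 < k\<close>:
    \<open>0 powr 0\<close> is 0 while \<open>0 ^ 0\<close> is 1.\<close>
  have powm: "ennreal (cmod z powr m) = ennreal (cmod z ^ (2 * k))" for z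
    using m by (cases "z = 0") (auto simp: m_def powr_realpow[symmetric] zero_power)
  have GJ: "ennreal_powr (\<integral>\<^sup>+ \<theta>. ennreal (cmod (S \<theta> x) powr p) \<partial>N) (q / p)
      \<le> ennreal_powr (J x) (q / m)"
    if [measurable]: "x \<in> space M" for x
  proof -
    have "ennreal_powr (\<integral>\<^sup>+ \<theta>. ennreal (cmod (S \<theta> x) powr p) \<partial>N) (m / p)
        \<le> (\<integral>\<^sup>+ \<theta>. ennreal ((cmod (S \<theta> x) powr p) powr (m / p)) \<partial>N)"
      using assms m by (intro N.ennreal_powr_nn_integral_le) (auto simp: field_simps)
    also have "\<dots> = J x"
      using assms by (simp add: J_def powr_powr powm)
    finally have "ennreal_powr (ennreal_powr (\<integral>\<^sup>+ \<theta>. ennreal (cmod (S \<theta> x) powr p) \<partial>N) (m / p)) (q / m)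
        \<le> ennreal_powr (J x) (q / m)"
      using assms m by (intro ennreal_powr_mono) auto
    then show ?thesis using m by (simp add: ennreal_powr_powr)
  qed
  have EJ: "(\<integral>\<^sup>+ x. J x \<partial>M) \<le> ennreal (moment_const k * V ^ k)"
  proof -
    have "(\<integral>\<^sup>+ x. J x \<partial>M) = (\<integral>\<^sup>+ \<theta>. (\<integral>\<^sup>+ x. ennreal (cmod (S \<theta> x) ^ (2 * k)) \<partial>M) \<partial>N)"
      unfolding J_def by (rule NM.Fubini') measurable
    also have "\<dots> \<le> (\<integral>\<^sup>+ \<theta>. ennreal (moment_const k * V ^ k) \<partial>N)"
      using moment_suminf[OF sb, of _ k] by (intro nn_integral_mono) (simp add: S_def V_def norm_b)
    finally show ?thesis by (simp add: N.emeasure_space_1)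
  qed
  show ?thesis
  proof (cases "V = 0")
    case True
    then have "\<beta> n = 0" for n
      using suminf_eq_zero_iff[OF s2] by (simp add: V_def)
    then have "b \<theta> n = 0" for \<theta> n using norm_b[of \<theta> n] by simp
    then show ?thesis by (simp add: ennreal_powr_def)
  next
    case False
    with \<open>0 \<le> V\<close> have V: "0 < V" by simp
    have Vk: "V powr real k = V ^ k" using V by (simp add: powr_realpow)
    \<comment> \<open>The quotient of \<open>J x\<close> by \<open>V ^ k\<close> has expectation at
      most \<open>moment_const k\<close>. Bounding its power by \<open>1 + t\<close> therefore loses
      a constant only and keeps the correct scaling in \<open>V\<close>.\<close>
    have "ennreal_powr (J x) (q / m)
        \<le> ennreal (V powr (q / 2)) * (1 + ennreal (1 / V ^ k) * J x)" for x
    proof -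
      have "J x = ennreal (V ^ k) * (ennreal (1 / V ^ k) * J x)"
        using V by (simp flip: mult.assoc ennreal_mult)
      then have "ennreal_powr (J x) (q / m)
          = ennreal ((V ^ k) powr (q / m)) * ennreal_powr (ennreal (1 / V ^ k) * J x) (q / m)"
        using V ennreal_powr_mult[of "V ^ k" "ennreal (1 / V ^ k) * J x" "q / m"] by simp
      also have "(V ^ k) powr (q / m) = V powr (q / 2)"
        using m by (simp add: Vk[symmetric] powr_powr m_def)
      also have "ennreal_powr (ennreal (1 / V ^ k) * J x) (q / m) \<le> 1 + ennreal (1 / V ^ k) * J x"
        using assms m by (intro ennreal_powr_le_one_plus) auto
      finally show ?thesis by (simp add: mult_left_mono)
    qed
    then have "(\<integral>\<^sup>+ x. ennreal_powr (\<integral>\<^sup>+ \<theta>. ennreal (cmod (S \<theta> x) powr p) \<partial>N) (q / p) \<partial>M)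
      \<le> (\<integral>\<^sup>+ x. ennreal (V powr (q / 2)) * (1 + ennreal (1 / V ^ k) * J x) \<partial>M)"
      by (intro nn_integral_mono order_trans[OF GJ]) auto
    also have "\<dots> = ennreal (V powr (q / 2)) * (1 + ennreal (1 / V ^ k) * (\<integral>\<^sup>+ x. J x \<partial>M))"
      by (simp add: nn_integral_cmult nn_integral_add emeasure_space_1)
    also have "\<dots>
        \<le> ennreal (V powr (q / 2)) * (1 + ennreal (1 / V ^ k) * ennreal (moment_const k * V ^ k))"
      by (intro mult_left_mono add_left_mono EJ) auto
    also have "ennreal (1 / V ^ k) * ennreal (moment_const k * V ^ k) = ennreal (moment_const k)"
      using V by (simp flip: ennreal_mult')
    also have "1 + ennreal (moment_const k) = ennreal (1 + moment_const k)"
      using moment_const_pos[of k] by simp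
    also have "ennreal (V powr (q / 2)) * ennreal (1 + moment_const k)
        = ennreal ((1 + moment_const k) * V powr (q / 2))"
      using moment_const_pos[of k] by (simp add: mult.commute del: ennreal_plus flip: ennreal_mult)
    finally show ?thesis by (simp add: S_def V_def)
  qed
qed

text \<open>\<open>D\<close> marks the pairs at which the series has at least half its variance, and
  \<open>H x\<close> is the \<open>N\<close>-mass of the good parameters at the sample point
  \<open>x\<close>. Tonelli turns the uniform Paley-Zygmund bound into mean at least
  \<open>c\<close> for \<open>H\<close>. As \<open>H\<close> is at most 1, that mean cannot be
  concentrated on a small event, so a fixed portion of it is found on \<open>B\<close> where
  \<open>H\<close> itself exceeds \<open>c / 4\<close>.\<close>

lemma mixed_moment_lower:
  assumes "0 < p" "0 < q" and B [measurable]: "B \<in> events" and PB: "1 - pz_const / 2 \<le> prob B"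
  shows "ennreal ((1 / 2) powr (q / 2) * (pz_const / 4) powr (q / p) * (pz_const / 4) * (\<Sum>n. (\<beta> n)\<^sup>2) powr (q / 2))
    \<le> (\<integral>\<^sup>+ x. indicator B x * ennreal_powr (\<integral>\<^sup>+ \<theta>. ennreal (cmod (\<Sum>n. b \<theta> n * X n x) powr p) \<partial>N) (q / p) \<partial>M)"
proof -
  define V where "V = (\<Sum>n. (\<beta> n)\<^sup>2)"
  define S where "S \<theta> x = (\<Sum>n. b \<theta> n * X n x)" for \<theta> x
  define r where "r = q / p"
  define c where "c = pz_const"
  have "0 < c" by (simp add: c_def pz_const_pos)
  have "0 < r" using assms by (simp add: r_def)
  have [measurable]: "case_prod S \<in> borel_measurable (N \<Otimes>\<^sub>M M)"
    unfolding S_def case_prod_beta by measurable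
  have [measurable]: "(\<lambda>x. S (f x) (g x)) \<in> borel_measurable L"
    if "f \<in> L \<rightarrow>\<^sub>M N" "g \<in> L \<rightarrow>\<^sub>M M" for f g and L :: "'c measure"
    using measurable_compose[OF measurable_Pair[OF that] \<open>case_prod S \<in> borel_measurable (N \<Otimes>\<^sub>M M)\<close>] by simp
  have sb: "summable (\<lambda>n. cmod (b \<theta> n))" for \<theta> using summable_\<beta> by (simp add: norm_b)
  have s2: "summable (\<lambda>n. (\<beta> n)\<^sup>2)" using summable_square_norm[OF sb] by (simp add: norm_b)
  have "0 \<le> V" unfolding V_def by (intro suminf_nonneg s2) auto
  define D where "D \<theta> x = (if V / 2 \<le> (cmod (S \<theta> x))\<^sup>2 then 1 else 0 :: ennreal)" for \<theta> x
  define H where "H x = (\<integral>\<^sup>+ \<theta>. D \<theta> x \<partial>N)" for x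
  have [measurable]: "case_prod D \<in> borel_measurable (N \<Otimes>\<^sub>M M)"
    unfolding D_def case_prod_beta by measurable
  have [measurable]: "H \<in> borel_measurable M" unfolding H_def by measurable
  have H1: "H x \<le> 1" for x
  proof -
    have "H x \<le> (\<integral>\<^sup>+ \<theta>. 1 \<partial>N)" unfolding H_def D_def by (intro nn_integral_mono) auto
    then show ?thesis by (simp add: N.emeasure_space_1)
  qed
  have G: "ennreal ((V / 2) powr (q / 2)) * ennreal_powr (H x) r
      \<le> ennreal_powr (\<integral>\<^sup>+ \<theta>. ennreal (cmod (S \<theta> x) powr p) \<partial>N) r" if [measurable]: "x \<in> space M" for x
  proof -
    have [measurable]: "(\<lambda>\<theta>. D \<theta> x) \<in> borel_measurable N" unfolding D_def by measurable
    have "ennreal ((V / 2) powr (p / 2)) * H x = (\<integral>\<^sup>+ \<theta>. ennreal ((V / 2) powr (p / 2)) * D \<theta> x \<partial>N)"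
      unfolding H_def by (simp add: nn_integral_cmult)
    also have "\<dots> \<le> (\<integral>\<^sup>+ \<theta>. ennreal (cmod (S \<theta> x) powr p) \<partial>N)"
    proof (intro nn_integral_mono)
      fix \<theta>
      have "(V / 2) powr (p / 2) \<le> cmod (S \<theta> x) powr p" if "V / 2 \<le> (cmod (S \<theta> x))\<^sup>2"
      proof -
        have "(V / 2) powr (p / 2) \<le> ((cmod (S \<theta> x))\<^sup>2) powr (p / 2)"
          using assms \<open>0 \<le> V\<close> that by (intro powr_mono2) auto
        also have "\<dots> = cmod (S \<theta> x) powr p"
          by (cases "S \<theta> x = 0") (auto simp: powr_powr simp flip: powr_numeral)
        finally show ?thesis .
      qed
      then show "ennreal ((V / 2) powr (p / 2)) * D \<theta> x \<le> ennreal (cmod (S \<theta> x) powr p)"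
        by (auto simp: D_def intro: ennreal_leI)
    qed
    finally have "ennreal_powr (ennreal ((V / 2) powr (p / 2)) * H x) r
        \<le> ennreal_powr (\<integral>\<^sup>+ \<theta>. ennreal (cmod (S \<theta> x) powr p) \<partial>N) r"
      using \<open>0 < r\<close> by (rule ennreal_powr_mono[rotated])
    then show ?thesis using assms by (simp add: ennreal_powr_mult powr_powr r_def)
  qed
  have EH: "ennreal c \<le> (\<integral>\<^sup>+ x. H x \<partial>M)"
  proof -
    have "ennreal c = (\<integral>\<^sup>+ \<theta>. ennreal c \<partial>N)" by (simp add: N.emeasure_space_1)
    also have "\<dots> \<le> (\<integral>\<^sup>+ \<theta>. (\<integral>\<^sup>+ x. D \<theta> x \<partial>M) \<partial>N)"
    proof (intro nn_integral_mono)
      fix \<theta> assume [measurable]: "\<theta> \<in> space N"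
      have "ennreal c \<le> emeasure M {x \<in> space M. V / 2 \<le> (cmod (S \<theta> x))\<^sup>2}"
        using paley_zygmund_suminf[OF sb, of \<theta>]
        by (auto simp: c_def V_def S_def norm_b emeasure_eq_measure intro!: ennreal_leI)
      also have "\<dots> = (\<integral>\<^sup>+ x. indicator {x \<in> space M. V / 2 \<le> (cmod (S \<theta> x))\<^sup>2} x \<partial>M)"
        by (rule nn_integral_indicator[symmetric]) measurable
      also have "\<dots> = (\<integral>\<^sup>+ x. D \<theta> x \<partial>M)"
        by (intro nn_integral_cong) (auto simp: D_def)
      finally show "ennreal c \<le> (\<integral>\<^sup>+ x. D \<theta> x \<partial>M)" .
    qed
    also have "\<dots> = (\<integral>\<^sup>+ x. H x \<partial>M)"
      unfolding H_def by (rule NM.Fubini'[symmetric]) measurable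
    finally show ?thesis .
  qed
  define K where "K = (\<integral>\<^sup>+ x. indicator B x * ennreal_powr (H x) r \<partial>M)"
  \<comment> \<open>Off \<open>B\<close> the bound 1 is used. On \<open>B\<close>, either
    \<open>H x\<close> is at most \<open>c / 4\<close>, or its quotient by \<open>c / 4\<close> has
    \<open>r\<close>-th power at least 1, which dominates \<open>H x\<close>. This works for
    \<open>r\<close> above as well as below 1.\<close>
  have ptw: "H x
      \<le> indicator (space M - B) x + ennreal (c / 4) + ennreal ((c / 4) powr - r) * (indicator B x * ennreal_powr (H x) r)"
    if "x \<in> space M" for x
  proof (cases "x \<in> B")
    case True
    obtain h where h: "H x = ennreal h" "0 \<le> h" "h \<le> 1"
      using H1[of x] by (cases "H x") (auto simp: top_unique)
    have "h \<le> c / 4 + (c / 4) powr - r * h powr r"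
    proof (cases "h \<le> c / 4")
      case True
      then show ?thesis by (simp add: add_increasing2)
    next
      case False
      then have "1 \<le> (h / (c / 4)) powr r" using \<open>0 < c\<close> \<open>0 < r\<close>
        by (intro ge_one_powr_ge_zero) auto
      also have "\<dots> = (c / 4) powr - r * h powr r" using h \<open>0 < c\<close>
        by (subst powr_divide) (auto simp: powr_minus field_simps)
      finally show ?thesis using h \<open>0 < c\<close> by linarith
    qed
    then show ?thesis using True h \<open>0 < c\<close>
      by (simp add: ennreal_powr_ennreal flip: ennreal_plus ennreal_mult)
  next
    case False
    then show ?thesis using H1[of x] that by (simp add: add_increasing2 add.assoc)
  qed
  have "ennreal c \<le> (\<integral>\<^sup>+ x. H x \<partial>M)" by (rule EH)
  also have "\<dots>
      \<le> (\<integral>\<^sup>+ x. indicator (space M - B) x + ennreal (c / 4) + ennreal ((c / 4) powr - r) * (indicator B x * ennreal_powr (H x) r) \<partial>M)"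
    by (intro nn_integral_mono ptw)
  also have "\<dots> = emeasure M (space M - B) + ennreal (c / 4) + ennreal ((c / 4) powr - r) * K"
    by (simp add: nn_integral_add nn_integral_cmult emeasure_space_1 K_def)
  \<comment> \<open>Of the mean \<open>c\<close>, the complement of \<open>B\<close> takes at most
    \<open>c / 2\<close> and the cut level \<open>c / 4\<close>, which leaves \<open>c / 4\<close>
    for the term with \<open>K\<close>.\<close>
  also have "\<dots> \<le> ennreal (c / 2) + ennreal (c / 4) + ennreal ((c / 4) powr - r) * K"
    using PB by (intro add_mono order_refl)
      (auto simp: emeasure_eq_measure prob_compl c_def intro!: ennreal_leI)
  finally have "ennreal c \<le> ennreal (3 * c / 4) + ennreal ((c / 4) powr - r) * K"
    using \<open>0 < c\<close> by (simp flip: ennreal_plus)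
  then have K: "ennreal ((c / 4) powr r * (c / 4)) \<le> K"
  proof (cases K)
    case (real k)
    assume "ennreal c \<le> ennreal (3 * c / 4) + ennreal ((c / 4) powr - r) * K"
    then have "c \<le> 3 * c / 4 + (c / 4) powr - r * k"
      using real \<open>0 < c\<close> by (simp flip: ennreal_plus ennreal_mult)
    then have "(c / 4) powr r * (c / 4) \<le> (c / 4) powr r * ((c / 4) powr - r * k)"
      by (intro mult_left_mono) auto
    also have "\<dots> = k" using \<open>0 < c\<close> by (simp add: powr_minus flip: mult.assoc)
    finally have "(c / 4) powr r * (c / 4) \<le> k" .
    then show ?thesis using real by (simp add: ennreal_leI)
  qed simp
  have "ennreal ((V / 2) powr (q / 2)) * ennreal ((c / 4) powr r * (c / 4))
      \<le> ennreal ((V / 2) powr (q / 2)) * K"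
    by (intro mult_left_mono K) simp
  also have "\<dots>
      = (\<integral>\<^sup>+ x. indicator B x * (ennreal ((V / 2) powr (q / 2)) * ennreal_powr (H x) r) \<partial>M)"
    unfolding K_def by (subst nn_integral_cmult[symmetric]) (auto simp: mult_ac)
  also have "\<dots>
      \<le> (\<integral>\<^sup>+ x. indicator B x * ennreal_powr (\<integral>\<^sup>+ \<theta>. ennreal (cmod (S \<theta> x) powr p) \<partial>N) r \<partial>M)"
    by (intro nn_integral_mono mult_left_mono G) auto
  finally show ?thesis
    using \<open>0 < c\<close> \<open>0 \<le> V\<close> unfolding S_def V_def[symmetric] c_def[symmetric] r_def[symmetric]
    by (simp add: powr_divide powr_one_eq_one mult_ac flip: ennreal_mult)
qed

end

end

section \<open>The standard random sequences\<close>

lemma measurable_cis [measurable]: "cis \<in> borel_measurable borel"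
  by (intro borel_measurable_continuous_onI continuous_intros)

text \<open>Built on \<open>lborel\<close> rather than on Lebesgue measure, so that products with
  the sample space stay within Borel measurability. It is also the law of the angle of a Steinhaus
  variable.\<close>

definition angle_measure :: "real measure" where
  "angle_measure = uniform_measure lborel {0..2 * pi}"

lemma prob_space_angle_measure: "prob_space angle_measure"
  unfolding angle_measure_def by (rule prob_space_uniform_measure) auto

lemma sets_angle_measure [measurable_cong, simp]: "sets angle_measure = sets borel"
  by (simp add: angle_measure_def)

lemma space_angle_measure [simp]: "space angle_measure = UNIV"
  by (simp add: angle_measure_def)

lemma integral_angle_measure:
  fixes f :: "real \<Rightarrow> complex"
  assumes [measurable]: "f \<in> borel_measurable borel"
  shows "(\<integral>\<theta>. f \<theta> \<partial>angle_measure)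
      = (\<integral>\<theta>. indicator {0..2 * pi} \<theta> *\<^sub>R f \<theta> \<partial>lborel) / of_real (2 * pi)"
proof -
  have eq: "angle_measure = density lborel (\<lambda>x. ennreal (indicator {0..2 * pi} x / (2 * pi)))"
    unfolding angle_measure_def uniform_measure_def
    by (intro density_cong AE_I2) (auto simp: divide_ennreal[symmetric] split: split_indicator)
  have "(\<integral>\<theta>. f \<theta> \<partial>angle_measure) = (\<integral>\<theta>. (indicator {0..2 * pi} \<theta> / (2 * pi)) *\<^sub>R f \<theta> \<partial>lborel)"
    unfolding eq by (subst integral_density) auto
  also have "\<dots> = (\<integral>\<theta>. (indicator {0..2 * pi} \<theta> *\<^sub>R f \<theta>) / of_real (2 * pi) \<partial>lborel)"
    by (intro Bochner_Integration.integral_cong refl)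
      (auto simp: scaleR_conv_of_real split: split_indicator)
  finally show ?thesis by (simp only: integral_divide_zero)
qed

text \<open>Orthogonality of the characters, by an explicit antiderivative for nonzero
  \<open>k\<close>. It gives the mean of the Steinhaus law and the orthonormality behind Parseval's
  identity.\<close>

lemma integral_cis_angle_measure:
  "(\<integral>\<theta>. cis (of_int k * \<theta>) \<partial>angle_measure) = (if k = 0 then 1 else 0)"
proof (cases "k = 0")
  case True
  interpret prob_space angle_measure by (rule prob_space_angle_measure)
  show ?thesis using True prob_space by simp
next
  case False
  have "(\<integral>\<theta>. indicator {0..2 * pi} \<theta> *\<^sub>R cis (of_int k * \<theta>) \<partial>lborel)
      = cis (of_int k * (2 * pi)) / (\<i> * of_int k) - cis (of_int k * 0) / (\<i> * of_int k)"
  proof (rule integral_FTC_atLeastAtMost)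
    fix x :: real
    have "((\<lambda>x. exp (\<i> * of_int k * x) / (\<i> * of_int k)) has_vector_derivative (exp (\<i> * of_int k * x))) (at x within {0..2 * pi})"
      using False by (auto intro!: derivative_eq_intros has_vector_derivative_real_field)
    then show "((\<lambda>x. cis (of_int k * x) / (\<i> * of_int k)) has_vector_derivative cis (of_int k * x)) (at x within {0..2 * pi})"
      by (simp add: cis_conv_exp mult_ac)
  qed (auto intro!: continuous_intros)
  also have "cis (of_int k * (2 * pi)) = 1"
    using cis_multiple_2pi[of "of_int k"] by (simp add: mult_ac)
  finally show ?thesis using False by (subst integral_angle_measure) auto
qed

definition standardized_subgaussian :: "complex measure \<Rightarrow> bool" where
  "standardized_subgaussian L \<longleftrightarrow>
     sets L = sets borel \<and>
     (\<forall>u. (\<integral>\<^sup>+ z. ennreal (exp (Re (u * z))) \<partial>L) \<le> ennreal (exp ((cmod u)\<^sup>2 / 2))) \<and>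
     (\<integral>z. z \<partial>L) = 0 \<and> (\<integral>z. (cmod z)\<^sup>2 \<partial>L) = 1"

text \<open>Hoeffding's lemma for the bounded centred variable \<open>Re (u * z)\<close>. This
  covers the Bernoulli and the Steinhaus law together.\<close>

lemma standardized_subgaussian_unimodular:
  assumes "prob_space L" and [simp, measurable_cong]: "sets L = sets borel"
    and norm: "AE z in L. cmod z = 1" and "(\<integral>z. z \<partial>L) = 0"
  shows "standardized_subgaussian L"
proof -
  interpret prob_space L by (rule assms)
  have "(\<integral>\<^sup>+ z. ennreal (exp (Re (u * z))) \<partial>L) \<le> ennreal (exp ((cmod u)\<^sup>2 / 2))" for u
  proof -
    have AE: "AE z in L. Re (u * z) \<in> {- cmod u..cmod u}"
      using norm
    proof eventually_elim
      case (elim z)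
      have "\<bar>Re (u * z)\<bar> \<le> cmod (u * z)" by (rule abs_Re_le_cmod)
      then show ?case using elim
        by (simp add: norm_mult abs_le_iff minus_le_iff del: times_complex.sel)
    qed
    interpret interval_bounded_random_variable L "\<lambda>z. Re (u * z)" "- cmod u" "cmod u"
      by unfold_locales (use AE in auto)
    have int: "integrable L (\<lambda>z. z)"
      by (rule integrable_const_bound[where B = 1]) (use norm in auto)
    have "expectation (\<lambda>z. Re (u * z)) = Re (expectation (\<lambda>z. u * z))"
      by (rule integral_Re) (simp add: int)
    also have "\<dots> = 0" using int assms by simp
    finally have "expectation (\<lambda>z. Re (u * z)) = 0" .
    \<comment> \<open>The interval has length \<open>2 * cmod u\<close>, so the exponent
      \<open>(2 * cmod u)\<^sup>2 / 8\<close> is the required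
      \<open>(cmod u)\<^sup>2 / 2\<close>.\<close>
    from Hoeffdings_lemma_nn_integral_0[OF _ this, of 1] show ?thesis
      by (simp add: power2_eq_square field_simps)
  qed
  moreover have "expectation (\<lambda>z. (cmod z)\<^sup>2) = expectation (\<lambda>z. 1)"
    by (rule integral_cong_AE) (use norm in auto)
  ultimately show ?thesis using assms prob_space by (simp add: standardized_subgaussian_def)
qed

lemma standardized_subgaussian_bernoulli: "standardized_subgaussian bernoulli_law"
proof (rule standardized_subgaussian_unimodular)
  show "prob_space bernoulli_law"
    unfolding bernoulli_law_def by (rule measure_pmf.prob_space_distr) simp
  show "AE z in bernoulli_law. cmod z = 1"
    unfolding bernoulli_law_def by (subst AE_distr_iff) (auto simp: AE_measure_pmf_iff)
  have "measure_pmf.expectation (pmf_of_set {1, -1}) (\<lambda>x. x)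
      = (\<Sum>a\<in>{1, -1}. pmf (pmf_of_set {1, -1}) a *\<^sub>R (a :: complex))"
    by (rule integral_measure_pmf) auto
  then show "(\<integral>z. z \<partial>bernoulli_law) = 0"
    unfolding bernoulli_law_def by (subst integral_distr) auto
qed (simp add: bernoulli_law_def)

lemma standardized_subgaussian_steinhaus: "standardized_subgaussian steinhaus_law"
proof (rule standardized_subgaussian_unimodular)
  note steinhaus = steinhaus_law_def[folded angle_measure_def]
  show "prob_space steinhaus_law"
    unfolding steinhaus
      by (rule prob_space.prob_space_distr[OF prob_space_angle_measure]) measurable
  show "AE z in steinhaus_law. cmod z = 1"
    unfolding steinhaus by (subst AE_distr_iff) auto
  show "(\<integral>z. z \<partial>steinhaus_law) = 0"
    unfolding steinhaus using integral_cis_angle_measure[of 1] by (subst integral_distr) auto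
qed (simp add: steinhaus_law_def)

text \<open>The law lives on the real line, so the exponential only sees \<open>Re u\<close>.
  Completing the square gives the exact value \<open>exp ((Re u)\<^sup>2 / 2)\<close>.\<close>

lemma standardized_subgaussian_gaussian: "standardized_subgaussian gaussian_law"
proof -
  have "(\<integral>\<^sup>+ z. ennreal (exp (Re (u * z))) \<partial>gaussian_law) \<le> ennreal (exp ((cmod u)\<^sup>2 / 2))" for u
  proof -
    have eq: "std_normal_density x * exp (Re u * x)
        = exp ((Re u)\<^sup>2 / 2) * normal_density (Re u) 1 x" for x
      by (simp add: normal_density_def power2_eq_square field_simps flip: exp_add)
    have "(\<integral>\<^sup>+ z. ennreal (exp (Re (u * z))) \<partial>gaussian_law)
        = (\<integral>\<^sup>+ x. ennreal (std_normal_density x * exp (Re u * x)) \<partial>lborel)"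
      unfolding gaussian_law_def
        by (simp add: nn_integral_distr nn_integral_density ennreal_mult normal_density_nonneg)
    also have "\<dots>
        = (\<integral>\<^sup>+ x. ennreal (exp ((Re u)\<^sup>2 / 2)) * ennreal (normal_density (Re u) 1 x) \<partial>lborel)"
      unfolding eq by (simp add: ennreal_mult normal_density_nonneg)
    also have "\<dots>
        = ennreal (exp ((Re u)\<^sup>2 / 2)) * emeasure (density lborel (normal_density (Re u) 1)) UNIV"
      by (simp add: nn_integral_cmult emeasure_density)
    also have "emeasure (density lborel (normal_density (Re u) 1)) UNIV = 1"
      using prob_space.emeasure_space_1[OF prob_space_normal_density[of 1 "Re u"]] by simp
    also have "(Re u)\<^sup>2 \<le> (cmod u)\<^sup>2"
      by (simp add: cmod_power2)
    then have "ennreal (exp ((Re u)\<^sup>2 / 2)) * 1 \<le> ennreal (exp ((cmod u)\<^sup>2 / 2))"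
      by (simp add: ennreal_leI)
    finally show ?thesis .
  qed
  moreover have "(\<integral>z. z \<partial>gaussian_law) = 0"
    unfolding gaussian_law_def
    using integral_std_normal_moment_odd[of 0] by (subst integral_distr)
      (auto simp: integral_density)
  moreover have "(\<integral>z. (cmod z)\<^sup>2 \<partial>gaussian_law) = 1"
    unfolding gaussian_law_def
    using std_normal_distribution_even_moments(1)[of 1]
      by (subst integral_distr) (auto simp: numeral_2_eq_2[symmetric])
  ultimately show ?thesis by (simp add: standardized_subgaussian_def gaussian_law_def)
qed

lemma standard_random_sequence_subgaussian:
  assumes "prob_space M" and X: "standard_random_sequence M X"
  shows "subgaussian_sequence M X"
proof -
  interpret prob_space M by (rule assms)
  have ind: "indep_vars (\<lambda>_. borel) X UNIV" using X by (simp add: standard_random_sequence_def)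
  then have [measurable]: "X n \<in> borel_measurable M" for n by (auto simp: indep_vars_def)
  obtain L where L: "standardized_subgaussian L" and distr: "\<And>n. distr M borel (X n) = L"
    using X standardized_subgaussian_bernoulli standardized_subgaussian_steinhaus standardized_subgaussian_gaussian
    by (auto simp: standard_random_sequence_def)
  show ?thesis
  proof
    fix n u
    have "(\<integral>\<^sup>+ x. ennreal (exp (Re (u * X n x))) \<partial>M) = (\<integral>\<^sup>+ z. ennreal (exp (Re (u * z))) \<partial>L)"
      unfolding distr[of n, symmetric] by (subst nn_integral_distr) auto
    then show "(\<integral>\<^sup>+ x. ennreal (exp (Re (u * X n x))) \<partial>M) \<le> ennreal (exp ((cmod u)\<^sup>2 / 2))"
      using L by (simp add: standardized_subgaussian_def)
    have "expectation (X n) = (\<integral>z. z \<partial>L)"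
      unfolding distr[of n, symmetric] by (subst integral_distr) auto
    then show "expectation (X n) = 0"
      using L by (simp add: standardized_subgaussian_def)
    have "expectation (\<lambda>x. (cmod (X n x))\<^sup>2) = (\<integral>z. (cmod z)\<^sup>2 \<partial>L)"
      unfolding distr[of n, symmetric] by (subst integral_distr) auto
    then show "expectation (\<lambda>x. (cmod (X n x))\<^sup>2) = 1"
      using L by (simp add: standardized_subgaussian_def)
  qed (rule ind)
qed

section \<open>Polar coordinates and circular means\<close>

text \<open>The map \<open>g\<close> sends \<open>z\<close> to its modulus and its angle in
  \<open>(0, 2 * pi)\<close>. It is differentiable off a half-line, and differentiable maps between
  spaces of equal dimension preserve negligible sets, so the exceptional set stays null in polar
  coordinates.\<close>

lemma AE_polar:
  fixes P :: "complex \<Rightarrow> bool"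
  assumes "AE z in lborel. P z"
  shows "AE s in lborel. AE \<theta> in lborel. 0 < s \<longrightarrow> 0 < \<theta> \<longrightarrow> \<theta> < 2 * pi \<longrightarrow> P (of_real s * cis \<theta>)"
proof -
  obtain Z where Z: "Z \<in> null_sets lborel" "{z. \<not> P z} \<subseteq> Z"
    using assms by (auto elim!: AE_E simp: null_sets_def)
  \<comment> \<open>The nonnegative real axis is removed: there the angle read off from
    \<open>Ln (- z)\<close> jumps, and at 0 the modulus is not differentiable. The minus sign puts
    the cut on this axis, which the strict bounds on \<theta> avoid.\<close>
  define T where "T = {z \<in> Z. - z \<notin> \<real>\<^sub>\<le>\<^sub>0}"
  define g where "g z = (cmod z, Im (Ln (- z)) + pi)" for z
  have "negligible Z" using Z by (simp add: negligible_iff_null_sets null_sets_completionI)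
  then have "negligible T" by (rule negligible_subset) (auto simp: T_def)
  moreover have "g differentiable_on T"
  proof -
    have "(\<lambda>z. Ln (- z)) differentiable (at z)" if "z \<in> T" for z
    proof -
      have "(\<lambda>z. Ln (- z)) field_differentiable (at z)"
        using that by (auto simp: T_def field_differentiable_def intro!: derivative_eq_intros exI)
      then show ?thesis by (rule field_differentiable_imp_differentiable)
    qed
    moreover have "cmod differentiable (at z)" if "z \<in> T" for z
      using that by (intro differentiable_norm_at) (auto simp: T_def)
    ultimately have "g differentiable (at z)" if "z \<in> T" for z
      unfolding g_def using that
      by (intro differentiable_Pair differentiable_add differentiable_const
          differentiable_compose[OF bounded_linear_imp_differentiable[OF bounded_linear_Im]]) auto
    then show ?thesis by (simp add: differentiable_at_imp_differentiable_on)
  qed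
  ultimately have "negligible (g ` T)"
    by (intro negligible_differentiable_image_negligible) auto
  then have "AE v in lborel. v \<notin> g ` T"
    by (subst AE_completion_iff[symmetric]) (auto simp: negligible_iff_null_sets intro: AE_not_in)
  then have "AE v in lborel \<Otimes>\<^sub>M lborel. v \<notin> g ` T" by (simp only: lborel_prod)
  then have "AE s in lborel. AE \<theta> in lborel. (s, \<theta>) \<notin> g ` T" by (rule lborel_pair.AE_pair)
  moreover have "P (of_real s * cis \<theta>)" if "(s, \<theta>) \<notin> g ` T" "0 < s" "0 < \<theta>" "\<theta> < 2 * pi" for s \<theta>
  proof (rule ccontr)
    define z where "z = of_real s * cis \<theta>"
    assume "\<not> P (of_real s * cis \<theta>)"
    then have "z \<in> Z" using Z by (auto simp: z_def)
    have "- z \<noteq> 0" using that by (simp add: z_def)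
    have "exp (of_real (ln s) + \<i> * of_real (\<theta> - pi)) = of_real s * cis (\<theta> - pi)"
      using that by (simp only: exp_add exp_of_real exp_ln cis_conv_exp)
    also have "\<dots> = - z" by (simp add: z_def complex_eq_iff)
    finally have "exp (of_real (ln s) + \<i> * of_real (\<theta> - pi)) = - z" .
    then have "Ln (- z) = of_real (ln s) + \<i> * of_real (\<theta> - pi)"
      using that by (intro Ln_unique) auto
    then have Im: "Im (Ln (- z)) = \<theta> - pi" by simp
    have "- z \<notin> \<real>\<^sub>\<le>\<^sub>0"
    proof
      assume "- z \<in> \<real>\<^sub>\<le>\<^sub>0"
      then have "Re (- z) \<le> 0" "Im (- z) = 0" by (auto simp: complex_nonpos_Reals_iff)
      then have "Im (Ln (- z)) = pi" using \<open>- z \<noteq> 0\<close> 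
        by (subst Im_Ln_eq_pi) (auto simp: complex_eq_iff less_le)
      then show False using Im that by simp
    qed
    then have "z \<in> T" using \<open>z \<in> Z\<close> by (simp add: T_def)
    moreover have "g z = (s, \<theta>)" using that by (simp add: g_def Im) (simp add: z_def norm_mult)
    ultimately show False using that by (metis imageI)
  qed
  ultimately show ?thesis by (auto elim!: eventually_mono)
qed

section \<open>Rotation invariance of plane Lebesgue measure and finiteness of circular
  means\<close>

lemma nn_integral_lborel_complex:
  fixes f :: "complex \<Rightarrow> ennreal"
  assumes [measurable]: "f \<in> borel_measurable borel"
  shows "(\<integral>\<^sup>+ z. f z \<partial>lborel) = (\<integral>\<^sup>+ y. \<integral>\<^sup>+ x. f (Complex x y) \<partial>lborel \<partial>lborel)"
proof -
  have [measurable]: "(\<lambda>v. Complex (fst v) (snd v)) \<in> borel_measurable borel"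
    by (intro borel_measurable_continuous_onI continuous_intros)
  then have m: "(\<lambda>v. Complex (fst v) (snd v)) \<in> borel_measurable (lborel \<Otimes>\<^sub>M lborel)"
    by (simp add: lborel_prod)
  have eq: "lborel = distr (lborel \<Otimes>\<^sub>M lborel) borel (\<lambda>v. Complex (fst v) (snd v))"
  proof (rule lborel_eqI)
    fix l u :: complex
    assume lu: "\<And>b. b \<in> Basis \<Longrightarrow> l \<bullet> b \<le> u \<bullet> b"
    from lu[of 1] lu[of \<i>] have "Re l \<le> Re u" "Im l \<le> Im u"
      by (auto simp: Basis_complex_def inner_complex_def)
    have "(\<lambda>v. Complex (fst v) (snd v)) -` box l u \<inter> space (lborel \<Otimes>\<^sub>M lborel)
        = {Re l<..<Re u} \<times> {Im l<..<Im u}"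
      by (auto simp: box_def Basis_complex_def inner_complex_def space_pair_measure)
    then show "emeasure (distr (lborel \<Otimes>\<^sub>M lborel) borel (\<lambda>v. Complex (fst v) (snd v))) (box l u)
        = ennreal (\<Prod>b\<in>Basis. (u - l) \<bullet> b)"
      using \<open>Re l \<le> Re u\<close> \<open>Im l \<le> Im u\<close>
      by (simp add: emeasure_distr m lborel.emeasure_pair_measure_Times Basis_complex_def inner_complex_def ennreal_mult)
  qed simp
  have "(\<integral>\<^sup>+ z. f z \<partial>lborel) = (\<integral>\<^sup>+ v. f (Complex (fst v) (snd v)) \<partial>(lborel \<Otimes>\<^sub>M lborel))"
    by (subst eq) (rule nn_integral_distr[OF m], simp)
  also have "\<dots> = (\<integral>\<^sup>+ y. \<integral>\<^sup>+ x. f (Complex x y) \<partial>lborel \<partial>lborel)"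
    by (subst lborel_pair.nn_integral_snd[symmetric]) (auto simp: lborel_prod)
  finally show ?thesis .
qed

lemma nn_integral_lborel_shift:
  fixes f :: "real \<Rightarrow> ennreal"
  assumes "f \<in> borel_measurable borel"
  shows "(\<integral>\<^sup>+ x. f (x + c) \<partial>lborel) = (\<integral>\<^sup>+ x. f x \<partial>lborel)"
  using nn_integral_real_affine[OF assms, of 1 c] by (simp add: add.commute)

text \<open>With the other coordinate fixed, a shear is a translation, so Tonelli and translation
  invariance on the line are enough. The outer shears have slope \<open>- tan (\<phi> / 2)\<close>,
  whence the condition on the cosine; it excludes only countably many angles.\<close>

lemma nn_integral_rotate:
  fixes f :: "complex \<Rightarrow> ennreal"
  assumes [measurable]: "f \<in> borel_measurable borel" and "cos (\<phi> / 2) \<noteq> 0"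
  shows "(\<integral>\<^sup>+ z. f (cis \<phi> * z) \<partial>lborel) = (\<integral>\<^sup>+ z. f z \<partial>lborel)"
proof -
  have m[measurable]: "(\<lambda>v. Complex (fst v) (snd v)) \<in> borel_measurable (borel \<Otimes>\<^sub>M borel)"
    unfolding borel_prod by (intro borel_measurable_continuous_onI continuous_intros)
  have [measurable]: "(\<lambda>v. Complex (g v) (h v)) \<in> borel_measurable L"
    if "g \<in> borel_measurable L" "h \<in> borel_measurable L" for g h and L :: "'c measure"
    using measurable_compose[OF measurable_Pair[OF that] m] by simp
  have [measurable]: "(\<lambda>z. f (cis \<phi> * z)) \<in> borel_measurable borel" by measurable
  define \<psi> where "\<psi> = \<phi> / 2"
  have \<phi>: "\<phi> = 2 * \<psi>" by (simp add: \<psi>_def)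
  have c: "cos \<psi> \<noteq> 0" using assms by (simp add: \<psi>_def)
  \<comment> \<open>A rotation is a product of three shears.\<close>
  define t where "t = - sin \<psi> / cos \<psi>"
  define \<sigma> where "\<sigma> = sin \<phi>"
  have rot: "cis \<phi> * Complex x y
      = Complex (x + t * y + t * (y + \<sigma> * (x + t * y))) (y + \<sigma> * (x + t * y))" for x y
  proof -
    have cc: "cos \<psi> ^ 2 = 1 - sin \<psi> ^ 2" by (simp add: cos_squared_eq)
    have "\<sigma> = 2 * sin \<psi> * cos \<psi>" by (simp add: \<sigma>_def \<phi> sin_double)
    then have 1: "\<sigma> * t = - 2 * (sin \<psi>)\<^sup>2" using c by (simp add: t_def power2_eq_square)
    have c1: "cos \<phi> = 1 + \<sigma> * t" using 1 cc by (simp add: \<phi> cos_double)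
    have "t * (1 + cos \<phi>) = t * (2 * (cos \<psi>)\<^sup>2)" using cc by (simp add: \<phi> cos_double)
    also have "\<dots> = - sin \<phi>" using c by (simp add: t_def \<phi> sin_double power2_eq_square)
    finally have c2: "t * (2 + \<sigma> * t) = - \<sigma>" by (simp add: c1 \<sigma>_def)
    have c3: "sin \<phi> = \<sigma>" by (simp add: \<sigma>_def)
    have "- \<sigma> * y = t * (2 + \<sigma> * t) * y" by (simp add: c2)
    then show ?thesis by (simp add: complex_eq_iff c1 c3 algebra_simps)
  qed
  have "(\<integral>\<^sup>+ z. f (cis \<phi> * z) \<partial>lborel) = (\<integral>\<^sup>+ y. \<integral>\<^sup>+ x. f (cis \<phi> * Complex x y) \<partial>lborel \<partial>lborel)"
    by (rule nn_integral_lborel_complex) measurable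
  also have "\<dots> = (\<integral>\<^sup>+ y. \<integral>\<^sup>+ x. f (Complex (x + t * (y + \<sigma> * x)) (y + \<sigma> * x)) \<partial>lborel \<partial>lborel)"
    unfolding rot
  proof (rule nn_integral_cong)
    fix y
    show "(\<integral>\<^sup>+ x. f (Complex (x + t * y + t * (y + \<sigma> * (x + t * y))) (y + \<sigma> * (x + t * y))) \<partial>lborel)
      = (\<integral>\<^sup>+ x. f (Complex (x + t * (y + \<sigma> * x)) (y + \<sigma> * x)) \<partial>lborel)"
      by (rule nn_integral_lborel_shift[of "\<lambda>x. f (Complex (x + t * (y + \<sigma> * x)) (y + \<sigma> * x))" "t * y"]) measurable
  qed
  also have "\<dots> = (\<integral>\<^sup>+ x. \<integral>\<^sup>+ y. f (Complex (x + t * (y + \<sigma> * x)) (y + \<sigma> * x)) \<partial>lborel \<partial>lborel)"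
    by (rule lborel_pair.Fubini') measurable
  also have "\<dots> = (\<integral>\<^sup>+ x. \<integral>\<^sup>+ y. f (Complex (x + t * y) y) \<partial>lborel \<partial>lborel)"
  proof (rule nn_integral_cong)
    fix x
    show "(\<integral>\<^sup>+ y. f (Complex (x + t * (y + \<sigma> * x)) (y + \<sigma> * x)) \<partial>lborel)
        = (\<integral>\<^sup>+ y. f (Complex (x + t * y) y) \<partial>lborel)"
      by (rule nn_integral_lborel_shift[of "\<lambda>y. f (Complex (x + t * y) y)"]) measurable
  qed
  also have "\<dots> = (\<integral>\<^sup>+ y. \<integral>\<^sup>+ x. f (Complex (x + t * y) y) \<partial>lborel \<partial>lborel)"
    by (rule lborel_pair.Fubini'[symmetric]) measurable
  also have "\<dots> = (\<integral>\<^sup>+ y. \<integral>\<^sup>+ x. f (Complex x y) \<partial>lborel \<partial>lborel)"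
  proof (rule nn_integral_cong)
    fix y
    show "(\<integral>\<^sup>+ x. f (Complex (x + t * y) y) \<partial>lborel) = (\<integral>\<^sup>+ x. f (Complex x y) \<partial>lborel)"
      by (rule nn_integral_lborel_shift[of "\<lambda>x. f (Complex x y)"]) measurable
  qed
  also have "\<dots> = (\<integral>\<^sup>+ z. f z \<partial>lborel)"
    by (rule nn_integral_lborel_complex[symmetric]) measurable
  finally show ?thesis .
qed

lemma AE_circle_finite:
  fixes w :: "complex \<Rightarrow> ennreal"
  assumes [measurable]: "w \<in> borel_measurable borel"
    and fin: "(\<integral>\<^sup>+ z. w z * indicator (ball 0 1) z \<partial>lborel) < \<infinity>"
  shows "AE s in lborel. 0 < s \<longrightarrow> s < 1 \<longrightarrow> (\<integral>\<^sup>+ \<theta>. w (of_real s * cis \<theta>) * indicator {0..2 * pi} \<theta> \<partial>lborel) < \<infinity>"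
proof -
  \<comment> \<open>By rotation invariance the mass bounds the integral of \<open>I\<close>; this takes the place of
    integration in polar coordinates.\<close>
  define I where "I z = (\<integral>\<^sup>+ \<phi>. w (cis \<phi> * z) * indicator (ball 0 1) z * indicator {- 2 * pi..2 * pi} \<phi> \<partial>lborel)" for z
  have [measurable]: "ball 0 1 \<in> sets (borel :: complex measure)" "{- 2 * pi..2 * pi} \<in> sets borel"
    by auto
  have [measurable]: "I \<in> borel_measurable borel"
    unfolding I_def by measurable
  have "AE \<phi> in lborel. \<phi> \<notin> range (\<lambda>i::int. of_int i * pi)"
    by (intro AE_not_in countable_imp_null_set_lborel) auto
  then have cos: "AE \<phi>::real in lborel. cos (\<phi> / 2) \<noteq> 0"
    by eventually_elim (auto simp: cos_zero_iff_int)
  have "(\<integral>\<^sup>+ z. I z \<partial>lborel)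
      = (\<integral>\<^sup>+ \<phi>. \<integral>\<^sup>+ z. w (cis \<phi> * z) * indicator (ball 0 1) z * indicator {- 2 * pi..2 * pi} \<phi> \<partial>lborel \<partial>lborel)"
    unfolding I_def by (rule lborel_pair.Fubini') measurable
  also have "\<dots>
      = (\<integral>\<^sup>+ \<phi>. (\<integral>\<^sup>+ z. w z * indicator (ball 0 1) z \<partial>lborel) * indicator {- 2 * pi..2 * pi} \<phi> \<partial>lborel)"
  proof (rule nn_integral_cong_AE, use cos in eventually_elim)
    case (elim \<phi>)
    have "(\<integral>\<^sup>+ z. w (cis \<phi> * z) * indicator (ball 0 1) z \<partial>lborel)
        = (\<integral>\<^sup>+ z. w (cis \<phi> * z) * indicator (ball 0 1) (cis \<phi> * z) \<partial>lborel)"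
      by (intro nn_integral_cong) (auto simp: norm_mult split: split_indicator)
    also have "\<dots> = (\<integral>\<^sup>+ z. w z * indicator (ball 0 1) z \<partial>lborel)"
      by (rule nn_integral_rotate[OF _ elim]) measurable
    finally show ?case by (subst nn_integral_multc) auto
  qed
  also have "\<dots> = (\<integral>\<^sup>+ z. w z * indicator (ball 0 1) z \<partial>lborel) * ennreal (4 * pi)"
    by (subst nn_integral_cmult) auto
  also have "\<dots> < \<infinity>" using fin by (simp add: ennreal_mult_less_top)
  finally have "AE z in lborel. I z \<noteq> \<infinity>" by (intro nn_integral_PInf_AE) auto
  from AE_polar[OF this] show ?thesis
  proof eventually_elim
    case (elim s)
    show ?case
    proof (intro impI)
      assume s: "0 < s" "s < 1"
      \<comment> \<open>One angle with finite \<open>I\<close> settles the whole circle: every angle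
        in \<open>[0, 2 * pi]\<close> differs from it by at most \<open>2 * pi\<close>, and
        \<open>I\<close> integrates over rotations by \<open>- 2 * pi\<close> to
        \<open>2 * pi\<close>.\<close>
      have "\<exists>\<theta>. 0 < \<theta> \<and> \<theta> < 2 * pi \<and> I (of_real s * cis \<theta>) \<noteq> \<infinity>"
      proof (rule ccontr)
        assume "\<not> ?thesis"
        with elim s have "AE \<theta> in lborel. \<theta> \<notin> {0<..<2 * pi}" by (auto elim!: eventually_mono)
        then have "emeasure lborel {0<..<2 * pi} = 0"
          by (subst (asm) AE_iff_measurable[of "{0<..<2 * pi}"]) auto
        then show False by simp
      qed
      then obtain \<theta>0 where \<theta>0: "0 < \<theta>0" "\<theta>0 < 2 * pi" "I (of_real s * cis \<theta>0) < \<infinity>"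
        by (auto simp: less_top)
      have "(\<integral>\<^sup>+ \<theta>. w (of_real s * cis \<theta>) * indicator {0..2 * pi} \<theta> \<partial>lborel)
          = (\<integral>\<^sup>+ \<phi>. w (of_real s * cis (\<theta>0 + 1 * \<phi>)) * indicator {0..2 * pi} (\<theta>0 + 1 * \<phi>) \<partial>lborel)"
        by (subst nn_integral_real_affine[of _ 1 \<theta>0]) auto
      also have "\<dots> \<le> I (of_real s * cis \<theta>0)"
        unfolding I_def using s \<theta>0
        by (intro nn_integral_mono)
          (auto simp: norm_mult cis_mult[symmetric] mult_ac split: split_indicator)
      finally show "(\<integral>\<^sup>+ \<theta>. w (of_real s * cis \<theta>) * indicator {0..2 * pi} \<theta> \<partial>lborel) < \<infinity>"
        using \<theta>0(3) by (rule le_less_trans)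
    qed
  qed
qed

section \<open>Rewriting the radial and circular integrals with a Borel weight\<close>

lemma nn_integral_lebesgue_on:
  "S \<in> sets borel \<Longrightarrow> (\<integral>\<^sup>+ x. f x \<partial>lebesgue_on S) = (\<integral>\<^sup>+ x. f x * indicator S x \<partial>lborel)"
  by (subst nn_integral_restrict_space) (auto simp: nn_integral_completion)

lemma AE_lebesgue_on_iff:
  "S \<in> sets borel \<Longrightarrow> (AE x in lebesgue_on S. P x) \<longleftrightarrow> (AE x in lborel. x \<in> S \<longrightarrow> P x)"
  by (subst AE_restrict_space_iff) (auto simp: AE_completion_iff)

text \<open>Completeness of Lebesgue measure. It supplies the measurability of densities built from
  \<open>\<omega>\<close>, which agree with Borel functions only almost everywhere.\<close>

lemma borel_measurable_lebesgue_on_AE: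
  fixes f g :: "'a::euclidean_space \<Rightarrow> ennreal"
  assumes [measurable]: "S \<in> sets borel" "g \<in> borel_measurable borel"
    and eq: "AE x in lborel. x \<in> S \<longrightarrow> f x = g x"
  shows "f \<in> borel_measurable (lebesgue_on S)"
proof -
  have "(\<lambda>x. f x * indicator S x) \<in> borel_measurable lebesgue"
  proof (rule measurableI)
    fix A :: "ennreal set" assume [measurable]: "A \<in> sets borel"
    show "(\<lambda>x. f x * indicator S x) -` A \<inter> space lebesgue \<in> sets lebesgue"
    proof (rule completion.in_sets_AE)
      show "AE x in lebesgue. x \<in> (\<lambda>x. g x * indicator S x) -` A
          \<longleftrightarrow> x \<in> (\<lambda>x. f x * indicator S x) -` A \<inter> space lebesgue"
        unfolding AE_completion_iff using eq by eventually_elim (auto split: split_indicator)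
      have "(\<lambda>x. g x * indicator S x) -` A \<inter> space lborel \<in> sets lborel"
        by (rule measurable_sets[of _ _ borel]) measurable
      then show "(\<lambda>x. g x * indicator S x) -` A \<in> sets lebesgue"
        by (simp add: sets_completionI_sets)
    qed auto
  qed simp
  then show ?thesis by (subst borel_measurable_restrict_space_iff_ennreal) auto
qed

lemma nn_integral_angle_measure:
  fixes f :: "real \<Rightarrow> ennreal"
  assumes "f \<in> borel_measurable borel"
  shows "(\<integral>\<^sup>+ \<theta>. f \<theta> \<partial>angle_measure)
      = (\<integral>\<^sup>+ \<theta>. f \<theta> * indicator {0..2 * pi} \<theta> \<partial>lborel) / ennreal (2 * pi)"
  unfolding angle_measure_def using assms by (subst nn_integral_uniform_measure) auto

lemma weight_borel_version:
  assumes "weight \<omega>"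
  obtains w where "w \<in> borel_measurable borel" "AE z in lborel. z \<in> ball 0 1 \<longrightarrow> w z = \<omega> z"
proof -
  have "(\<lambda>z. \<omega> z * indicator (ball 0 1) z) \<in> borel_measurable lebesgue"
    using assms by (subst (asm) weight_def)
      (auto simp: borel_measurable_restrict_space_iff mult.commute)
  then obtain w where w: "w \<in> borel_measurable lborel" "AE z in lborel. \<omega> z * indicator (ball 0 1) z = w z"
    using completion_ex_borel_measurable_real by blast
  show ?thesis
  proof
    show "w \<in> borel_measurable borel" using w by simp
    show "AE z in lborel. z \<in> ball 0 1 \<longrightarrow> w z = \<omega> z"
      using w(2) by eventually_elim auto
  qed
qed

text \<open>The exceptional radii come from the null set where \<open>w\<close> and
  \<open>\<omega>\<close> differ. The quantifier over \<open>h\<close> stands inside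
  \<open>AE\<close>, so that one null set of radii serves all test functions; later \<open>h\<close>
  varies with the radius and with the sample point.\<close>

lemma circular_decomposition:
  assumes w [measurable]: "w \<in> borel_measurable borel"
    and w_eq: "AE z in lborel. z \<in> ball 0 1 \<longrightarrow> w z = \<omega> z"
    and c_def: "\<And>s. c s = (\<integral>\<^sup>+ \<theta>. ennreal (w (of_real s * cis \<theta>)) \<partial>angle_measure)"
  shows "AE s in lborel. 0 < s \<longrightarrow> s < 1 \<longrightarrow> circular_mean \<omega> s = c s \<and>
    (\<forall>h\<in>borel_measurable borel.
      (\<integral>\<^sup>+ \<theta>. h \<theta> \<partial>circular_measure \<omega> s) = (\<integral>\<^sup>+ \<theta>. h \<theta> * (ennreal (w (of_real s * cis \<theta>)) / c s) \<partial>angle_measure))"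
  using AE_polar[OF w_eq]
proof eventually_elim
  case (elim s)
  show ?case
  proof (intro impI)
    assume s: "0 < s" "s < 1"
    \<comment> \<open>\<open>AE_polar\<close> speaks of the open interval of angles; its two
      endpoints are discarded as null sets.\<close>
    have eq: "AE \<theta> in lborel. \<theta> \<in> {0..2 * pi} \<longrightarrow> \<omega> (of_real s * cis \<theta>) = w (of_real s * cis \<theta>)"
      using elim AE_lborel_singleton[of 0] AE_lborel_singleton[of "2 * pi"]
      by eventually_elim (use s in \<open>auto simp: norm_mult\<close>)
    have cm: "circular_mean \<omega> s = c s"
      unfolding circular_mean_def c_def
      by (subst nn_integral_angle_measure, measurable, subst nn_integral_lebesgue_on, simp,
          intro arg_cong2[where f = "(/)"] refl nn_integral_cong_AE)
         (use eq in \<open>eventually_elim, auto split: split_indicator\<close>)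
    have "(\<integral>\<^sup>+ \<theta>. h \<theta> \<partial>circular_measure \<omega> s)
        = (\<integral>\<^sup>+ \<theta>. h \<theta> * (ennreal (w (of_real s * cis \<theta>)) / c s) \<partial>angle_measure)"
      if [measurable]: "h \<in> borel_measurable borel" for h
    proof -
      have "(\<integral>\<^sup>+ \<theta>. h \<theta> \<partial>circular_measure \<omega> s)
          = (\<integral>\<^sup>+ \<theta>. ennreal (\<omega> (of_real s * cis \<theta>)) / c s / ennreal (2 * pi) * h \<theta> \<partial>lebesgue_on {0..2 * pi})"
        unfolding circular_measure_def cm
      proof (rule nn_integral_density)
        show "(\<lambda>\<theta>. ennreal (\<omega> (of_real s * cis \<theta>)) / c s / ennreal (2 * pi)) \<in> borel_measurable (lebesgue_on {0..2 * pi})"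
          by (rule borel_measurable_lebesgue_on_AE[where g = "\<lambda>\<theta>. ennreal (w (of_real s * cis \<theta>)) / c s / ennreal (2 * pi)"])
            (use eq in \<open>auto elim!: eventually_mono\<close>)
        show "h \<in> borel_measurable (lebesgue_on {0..2 * pi})"
          by (rule borel_measurable_lebesgue_on_AE[where g = h]) auto
      qed
      also have "\<dots>
          = (\<integral>\<^sup>+ \<theta>. h \<theta> * (ennreal (w (of_real s * cis \<theta>)) / c s) * indicator {0..2 * pi} \<theta> / ennreal (2 * pi) \<partial>lborel)"
        by (subst nn_integral_lebesgue_on, simp, rule nn_integral_cong_AE)
          (use eq in \<open>eventually_elim, auto simp: divide_ennreal_def mult_ac split: split_indicator\<close>)
      also have "\<dots> = (\<integral>\<^sup>+ \<theta>. h \<theta> * (ennreal (w (of_real s * cis \<theta>)) / c s) \<partial>angle_measure)"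
        by (simp add: nn_integral_divide nn_integral_angle_measure)
      finally show ?thesis .
    qed
    with cm show "circular_mean \<omega> s = c s \<and> (\<forall>h\<in>borel_measurable borel.
      (\<integral>\<^sup>+ \<theta>. h \<theta> \<partial>circular_measure \<omega> s) = (\<integral>\<^sup>+ \<theta>. h \<theta> * (ennreal (w (of_real s * cis \<theta>)) / c s) \<partial>angle_measure))"
      by blast
  qed
qed

text \<open>The integrand \<open>g\<close> is typically given through
  \<open>circular_measure\<close> and need not be Borel. It is exchanged for a Borel
  \<open>g'\<close>, with agreement demanded only where \<open>c\<close> is nonzero, since the
  radial measure has no mass on the other radii.\<close>

lemma nn_integral_radial_measure:
  assumes [measurable]: "c \<in> borel_measurable borel" "g' \<in> borel_measurable borel"
    and cm: "AE s in lborel. 0 < s \<longrightarrow> s < 1 \<longrightarrow> circular_mean \<omega> s = c s"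
    and eq: "AE s in lborel. 0 < s \<longrightarrow> s < 1 \<longrightarrow> c s \<noteq> 0 \<longrightarrow> g s = g' s"
  shows "(\<integral>\<^sup>+ s. g s \<partial>radial_measure \<omega>)
      = (\<integral>\<^sup>+ s. g' s * (c s * ennreal (2 * s) * indicator {0<..<1} s) \<partial>lborel)"
proof -
  have m: "(\<lambda>s. circular_mean \<omega> s * ennreal (2 * s)) \<in> borel_measurable (lebesgue_on {0<..<1})"
    by (rule borel_measurable_lebesgue_on_AE[where g = "\<lambda>s. c s * ennreal (2 * s)"])
      (use cm in \<open>auto elim!: eventually_mono\<close>)
  have m': "g' \<in> borel_measurable (lebesgue_on {0<..<1})"
    by (rule borel_measurable_lebesgue_on_AE[where g = g']) auto
  have "(\<integral>\<^sup>+ s. g s \<partial>radial_measure \<omega>) = (\<integral>\<^sup>+ s. g' s \<partial>radial_measure \<omega>)"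
  proof (rule nn_integral_cong_AE)
    show "AE s in radial_measure \<omega>. g s = g' s"
      unfolding radial_measure_def AE_density[OF m]
      by (subst AE_lebesgue_on_iff, simp, use cm eq in eventually_elim) auto
  qed
  also have "\<dots> = (\<integral>\<^sup>+ s. circular_mean \<omega> s * ennreal (2 * s) * g' s \<partial>lebesgue_on {0<..<1})"
    unfolding radial_measure_def by (rule nn_integral_density[OF m m'])
  also have "\<dots> = (\<integral>\<^sup>+ s. g' s * (c s * ennreal (2 * s) * indicator {0<..<1} s) \<partial>lborel)"
    by (subst nn_integral_lebesgue_on, simp, rule nn_integral_cong_AE)
      (use cm in \<open>eventually_elim, auto simp: mult_ac split: split_indicator\<close>)
  finally show ?thesis .
qed

section \<open>Random power series on circles\<close>

text \<open>For partial sums this is orthonormality of the characters. Dominated convergence passes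
  to the limit, since the partial sums are uniformly bounded by the sum of the moduli of the
  coefficients.\<close>

lemma parseval_circle:
  assumes c: "summable (\<lambda>n. cmod (c n))"
  shows "(\<integral>\<^sup>+ \<theta>. ennreal ((cmod (\<Sum>n. c n * cis \<theta> ^ n))\<^sup>2) \<partial>angle_measure)
      = ennreal (\<Sum>n. (cmod (c n))\<^sup>2)"
proof -
  interpret prob_space angle_measure by (rule prob_space_angle_measure)
  define S where "S N \<theta> = (\<Sum>n<N. c n * cis \<theta> ^ n)" for N \<theta>
  have sm: "summable (\<lambda>n. cmod (c n * cis \<theta> ^ n))" for \<theta> using c
    by (simp add: norm_mult norm_power)
  have pair: "cis \<theta> ^ m * cnj (cis \<theta> ^ n) = cis (of_int (int m - int n) * \<theta>)" for m n \<theta>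
    by (simp add: Complex.DeMoivre cis_cnj cis_mult algebra_simps del: cis_inverse)
  have fin: "expectation (\<lambda>\<theta>. (cmod (S N \<theta>))\<^sup>2) = (\<Sum>n<N. (cmod (c n))\<^sup>2)" for N
    unfolding S_def
  proof (rule second_moment_orthonormal)
    fix m n
    show "integrable angle_measure (\<lambda>\<theta>. cis \<theta> ^ m * cnj (cis \<theta> ^ n))"
      unfolding pair by (rule integrable_const_bound[where B = 1]) auto
    show "expectation (\<lambda>\<theta>. cis \<theta> ^ m * cnj (cis \<theta> ^ n)) = (if m = n then 1 else 0)"
      unfolding pair integral_cis_angle_measure by simp
  qed auto
  define B where "B = (\<Sum>n. cmod (c n))"
  have bound: "cmod (S N \<theta>) \<le> B" for N \<theta>
  proof -
    have "cmod (S N \<theta>) \<le> (\<Sum>n<N. cmod (c n * cis \<theta> ^ n))" unfolding S_def by (rule norm_sum)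
    also have "\<dots> \<le> B" unfolding B_def using c by (simp add: norm_mult norm_power sum_le_suminf)
    finally show ?thesis .
  qed
  have lim: "(\<lambda>N. (cmod (S N \<theta>))\<^sup>2) \<longlonglongrightarrow> (cmod (\<Sum>n. c n * cis \<theta> ^ n))\<^sup>2" for \<theta>
    unfolding S_def using summable_norm_cancel[OF sm[of \<theta>]]
      by (intro tendsto_intros summable_LIMSEQ)
  have bd2: "norm ((cmod (S N \<theta>))\<^sup>2) \<le> B\<^sup>2" for N \<theta>
    using bound[of N \<theta>] by (simp add: power_mono)
  have [measurable]: "(\<lambda>\<theta>. c n * cis \<theta> ^ n) \<in> borel_measurable borel" for n
    by (intro borel_measurable_continuous_onI continuous_intros)
  have *: "integrable angle_measure (\<lambda>\<theta>. (cmod (\<Sum>n. c n * cis \<theta> ^ n))\<^sup>2)"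
    "(\<lambda>N. expectation (\<lambda>\<theta>. (cmod (S N \<theta>))\<^sup>2)) \<longlonglongrightarrow> expectation (\<lambda>\<theta>. (cmod (\<Sum>n. c n * cis \<theta> ^ n))\<^sup>2)"
    using lim bd2
    by (auto intro!: integrable_dominated_convergence[where w = "\<lambda>_. B\<^sup>2"
      and s = "\<lambda>N \<theta>. (cmod (S N \<theta>))\<^sup>2"]
       integral_dominated_convergence[where w = "\<lambda>_. B\<^sup>2"] simp: S_def)
  have "expectation (\<lambda>\<theta>. (cmod (\<Sum>n. c n * cis \<theta> ^ n))\<^sup>2) = (\<Sum>n. (cmod (c n))\<^sup>2)"
    using *(2) summable_LIMSEQ[OF summable_square_norm[OF c]] unfolding fin by (rule LIMSEQ_unique)
  then show ?thesis using *(1) by (subst nn_integral_eq_integral) auto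
qed

lemma taylor_series_sums:
  assumes "f holomorphic_on ball 0 1" "cmod z < 1"
  shows "(\<lambda>n. taylor_coeff f n * z ^ n) sums f z"
  using holomorphic_power_series[OF assms(1), of z] assms(2) by (simp add: taylor_coeff_def)

lemma summable_taylor_coeff:
  assumes f: "f holomorphic_on ball 0 1" and s: "0 < s" "s < 1"
  shows "summable (\<lambda>n. cmod (taylor_coeff f n) * s ^ n)"
proof -
  \<comment> \<open>A radius strictly between \<open>s\<close> and 1: convergence at
    \<open>t\<close> gives absolute convergence at the smaller \<open>s\<close>.\<close>
  define t where "t = (1 + s) / 2"
  have t: "0 < t" "t < 1" "s < t" using s by (auto simp: t_def)
  have "summable (\<lambda>n. taylor_coeff f n * of_real t ^ n)"
    using taylor_series_sums[OF f, of "of_real t"] t by (simp add: sums_iff)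
  then have "summable (\<lambda>n. norm (taylor_coeff f n * of_real s ^ n))"
    by (rule powser_insidea) (use s t in auto)
  then show ?thesis using s by (simp add: norm_mult norm_power)
qed

lemma integral_mean_2:
  assumes f: "f holomorphic_on ball 0 1" and s: "0 < s" "s < 1"
  shows "integral_mean 2 f s = ennreal ((\<Sum>n. (cmod (taylor_coeff f n) * s ^ n)\<^sup>2) powr (1 / 2))"
proof -
  have sm: "summable (\<lambda>n. cmod (taylor_coeff f n * of_real s ^ n))"
    using summable_taylor_coeff[OF f s] s by (simp add: norm_mult norm_power)
  have eq: "cmod (f (of_real s * cis \<theta>)) powr 2
      = (cmod (\<Sum>n. taylor_coeff f n * of_real s ^ n * cis \<theta> ^ n))\<^sup>2" for \<theta>
    using taylor_series_sums[OF f, of "of_real s * cis \<theta>"] s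
    by (simp add: norm_mult sums_iff power_mult_distrib mult.assoc)
  have "(\<integral>\<^sup>+ \<theta>. ennreal (cmod (f (of_real s * cis \<theta>)) powr 2) \<partial>lebesgue_on {0..2 * pi}) / ennreal (2 * pi)
      = (\<integral>\<^sup>+ \<theta>. ennreal ((cmod (\<Sum>n. taylor_coeff f n * of_real s ^ n * cis \<theta> ^ n))\<^sup>2) \<partial>angle_measure)"
    unfolding eq
      by (subst nn_integral_lebesgue_on, simp, rule nn_integral_angle_measure[symmetric]) measurable
  also have "\<dots> = ennreal (\<Sum>n. (cmod (taylor_coeff f n) * s ^ n)\<^sup>2)"
    using parseval_circle[OF sm] s by (simp add: norm_mult norm_power)
  finally show ?thesis
    using summable_square_norm[OF sm] s
    by (simp add: integral_mean_def ennreal_powr_ennreal suminf_nonneg norm_mult norm_power)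
qed

text \<open>The density of the radial measure with respect to \<open>lborel\<close>, with a Borel
  \<open>c\<close> for the circular mean. It vanishes where \<open>c\<close> does and outside the
  unit interval, and there it cancels the meaningless values of the inner integrals.\<close>

definition radial_density :: "(real \<Rightarrow> ennreal) \<Rightarrow> real \<Rightarrow> ennreal" where
  "radial_density c s = c s * ennreal (2 * s) * indicator {0<..<1} s"

section \<open>Almost sure finiteness of the random mixed norm\<close>

context subgaussian_sequence
begin

definition random_circle_norm ::
    "(nat \<Rightarrow> complex) \<Rightarrow> (complex \<Rightarrow> real) \<Rightarrow> (real \<Rightarrow> ennreal) \<Rightarrow> real \<Rightarrow> real \<Rightarrow> real \<Rightarrow> 'a \<Rightarrow> ennreal" where
  "random_circle_norm a w c p q s x = ennreal_powr
    (\<integral>\<^sup>+ \<theta>. ennreal (cmod (\<Sum>n. a n * (of_real s * cis \<theta>) ^ n * X n x) powr p) * (ennreal (w (of_real s * cis \<theta>)) / c s)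
       \<partial>angle_measure) (q / p)"

text \<open>
  In the application \<open>w\<close> is a Borel version of the weight, so that everything below is jointly
  measurable, and \<open>c\<close> is its circular mean.
\<close>

context
  fixes a :: "nat \<Rightarrow> complex" and w :: "complex \<Rightarrow> real" and c :: "real \<Rightarrow> ennreal" and p q :: real
  assumes pos: "0 < p" "0 < q"
    and summable_a: "\<And>s. 0 < s \<Longrightarrow> s < 1 \<Longrightarrow> summable (\<lambda>n. cmod (a n) * s ^ n)"
    and w_measurable [measurable]: "w \<in> borel_measurable borel"
    and c_def: "\<And>s. c s = (\<integral>\<^sup>+ \<theta>. ennreal (w (of_real s * cis \<theta>)) \<partial>angle_measure)"
    and c_finite: "AE s in lborel. 0 < s \<longrightarrow> s < 1 \<longrightarrow> c s < \<infinity>"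
begin

interpretation angle: prob_space angle_measure by (rule prob_space_angle_measure)
interpretation LM: pair_sigma_finite lborel M by unfold_locales

lemma measurable_c [measurable]: "c \<in> borel_measurable borel"
  unfolding c_def[abs_def] by measurable

lemma measurable_radial_density [measurable]: "radial_density c \<in> borel_measurable borel"
  unfolding radial_density_def[abs_def] by measurable

lemma measurable_random_circle_norm [measurable]:
  "case_prod (random_circle_norm a w c p q) \<in> borel_measurable (lborel \<Otimes>\<^sub>M M)"
  unfolding random_circle_norm_def[abs_def] by measurable

text \<open>Division by \<open>c s\<close> makes the circular measure \<open>N\<close> a probability
  measure, so the mixed moment bounds apply to it. Their constants do not depend on
  \<open>s\<close>, which allows integration over the radius.\<close>

lemma random_circle_norm_bounds:
  assumes s: "0 < s" "s < 1" and cs: "c s \<noteq> 0" "c s \<noteq> \<infinity>"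
  shows "p \<le> 2 * real k \<Longrightarrow> q \<le> 2 * real k \<Longrightarrow>
      (\<integral>\<^sup>+ x. random_circle_norm a w c p q s x \<partial>M) \<le> ennreal ((1 + moment_const k) * (\<Sum>n. (cmod (a n) * s ^ n)\<^sup>2) powr (q / 2))"
    and "B \<in> events \<Longrightarrow> 1 - pz_const / 2 \<le> prob B \<Longrightarrow>
      ennreal ((1 / 2) powr (q / 2) * (pz_const / 4) powr (q / p) * (pz_const / 4) * (\<Sum>n. (cmod (a n) * s ^ n)\<^sup>2) powr (q / 2))
      \<le> (\<integral>\<^sup>+ x. indicator B x * random_circle_norm a w c p q s x \<partial>M)"
proof -
  define N where "N = density angle_measure (\<lambda>\<theta>. ennreal (w (of_real s * cis \<theta>)) / c s)"
  have "emeasure N (space N) = 1"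
    using cs by (simp add: N_def emeasure_density nn_integral_divide less_top flip: c_def)
  then have N: "prob_space N" by (rule prob_spaceI)
  have G: "random_circle_norm a w c p q s x
      = ennreal_powr (\<integral>\<^sup>+ \<theta>. ennreal (cmod (\<Sum>n. a n * (of_real s * cis \<theta>) ^ n * X n x) powr p) \<partial>N) (q / p)"
    if [measurable]: "x \<in> space M" for x
    unfolding random_circle_norm_def N_def
      by (subst nn_integral_density) (auto simp: mult.commute)
  have m: "(\<lambda>\<theta>. a n * (of_real s * cis \<theta>) ^ n) \<in> borel_measurable N" for n
    unfolding N_def by measurable
  have nrm: "cmod (a n * (of_real s * cis \<theta>) ^ n) = cmod (a n) * s ^ n" for \<theta> n
    using s by (simp add: norm_mult norm_power)
  show "(\<integral>\<^sup>+ x. random_circle_norm a w c p q s x \<partial>M)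
      \<le> ennreal ((1 + moment_const k) * (\<Sum>n. (cmod (a n) * s ^ n)\<^sup>2) powr (q / 2))"
    if "p \<le> 2 * real k" "q \<le> 2 * real k"
    using mixed_moment_upper[OF N m nrm summable_a[OF s] pos that]
      by (simp add: G cong: nn_integral_cong)
  show "ennreal ((1 / 2) powr (q / 2) * (pz_const / 4) powr (q / p) * (pz_const / 4) * (\<Sum>n. (cmod (a n) * s ^ n)\<^sup>2) powr (q / 2))
      \<le> (\<integral>\<^sup>+ x. indicator B x * random_circle_norm a w c p q s x \<partial>M)"
    if "B \<in> events" "1 - pz_const / 2 \<le> prob B"
    using mixed_moment_lower[OF N m nrm summable_a[OF s] pos that]
      by (simp add: G cong: nn_integral_cong)
qed

text \<open>Finite expectation implies almost sure finiteness, which gives one direction. In the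
  other, \<open>\<Phi>\<close> might have infinite expectation, so it is truncated to an event on
  which it is bounded; the lower bound for the circle norms tolerates the loss of the
  complement.\<close>

lemma AE_random_mixed_norm_finite_iff:
  "(AE x in M. (\<integral>\<^sup>+ s. random_circle_norm a w c p q s x * radial_density c s \<partial>lborel) < \<infinity>) \<longleftrightarrow>
   (\<integral>\<^sup>+ s. ennreal ((\<Sum>n. (cmod (a n) * s ^ n)\<^sup>2) powr (q / 2)) * radial_density c s \<partial>lborel) < \<infinity>"
proof
  define V where "V s = (\<Sum>n. (cmod (a n) * s ^ n)\<^sup>2) powr (q / 2)" for s
  define \<Phi> where "\<Phi> x = (\<integral>\<^sup>+ s. random_circle_norm a w c p q s x * radial_density c s \<partial>lborel)" for x
  have [measurable]: "(\<lambda>s. ennreal (V s)) \<in> borel_measurable borel" unfolding V_def by measurable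
  have [measurable]: "\<Phi> \<in> borel_measurable M"
  proof -
    have "(\<lambda>z. random_circle_norm a w c p q (snd z) (fst z)) \<in> borel_measurable (M \<Otimes>\<^sub>M lborel)"
      using measurable_compose[OF measurable_pair_swap' measurable_random_circle_norm]
        by (simp add: split_beta')
    then show ?thesis
      unfolding \<Phi>_def by (intro lborel.borel_measurable_nn_integral) (auto simp: split_beta')
  qed
  have sec [measurable]: "(\<lambda>x. random_circle_norm a w c p q s x) \<in> borel_measurable M" for s
    using measurable_Pair2[OF measurable_random_circle_norm, of s] by simp
  \<comment> \<open>The block lets both directions share the definitions and measurability facts
    above.\<close>
  {
    assume "(\<integral>\<^sup>+ s. ennreal (V s) * radial_density c s \<partial>lborel) < \<infinity>"
    obtain k :: nat where "max p q \<le> real k" using real_arch_simple by blast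
    then have k: "p \<le> 2 * real k" "q \<le> 2 * real k" by auto
    have "(\<integral>\<^sup>+ x. \<Phi> x \<partial>M)
        = (\<integral>\<^sup>+ s. \<integral>\<^sup>+ x. random_circle_norm a w c p q s x * radial_density c s \<partial>M \<partial>lborel)"
      unfolding \<Phi>_def by (rule LM.Fubini') (auto simp: split_beta')
    also have "\<dots>
        = (\<integral>\<^sup>+ s. (\<integral>\<^sup>+ x. random_circle_norm a w c p q s x \<partial>M) * radial_density c s \<partial>lborel)"
      by (simp add: nn_integral_multc)
    also have "\<dots>
        \<le> (\<integral>\<^sup>+ s. ennreal (1 + moment_const k) * (ennreal (V s) * radial_density c s) \<partial>lborel)"
    proof (rule nn_integral_mono_AE, use c_finite in eventually_elim)
      case (elim s)
      show ?case
      proof (cases "0 < s \<and> s < 1 \<and> c s \<noteq> 0")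
        case True
        then have "(\<integral>\<^sup>+ x. random_circle_norm a w c p q s x \<partial>M)
            \<le> ennreal (1 + moment_const k) * ennreal (V s)"
          using random_circle_norm_bounds(1)[of s k] elim k moment_const_pos[of k]
            by (simp add: V_def ennreal_mult less_top del: ennreal_plus)
        then show ?thesis by (simp add: mult_right_mono flip: mult.assoc del: ennreal_plus)
      qed (auto simp: radial_density_def)
    qed
    also have "\<dots>
        = ennreal (1 + moment_const k) * (\<integral>\<^sup>+ s. ennreal (V s) * radial_density c s \<partial>lborel)"
      by (rule nn_integral_cmult) measurable
    also have "\<dots> < \<infinity>"
      using \<open>(\<integral>\<^sup>+ s. ennreal (V s) * radial_density c s \<partial>lborel) < \<infinity>\<close>
        by (simp add: ennreal_mult_less_top del: ennreal_plus)
    finally have "AE x in M. \<Phi> x \<noteq> \<infinity>" by (intro nn_integral_PInf_AE) auto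
    then show "AE x in M. \<Phi> x < \<infinity>" by (simp add: less_top)
  next
    assume fin: "AE x in M. \<Phi> x < \<infinity>"
    define B where "B K = {x \<in> space M. \<Phi> x \<le> of_nat K}" for K :: nat
    have [measurable]: "B K \<in> events" for K unfolding B_def by measurable
    have "(\<lambda>K. prob (B K)) \<longlonglongrightarrow> prob (\<Union>K. B K)"
      by (rule finite_Lim_measure_incseq) (auto simp: incseq_def B_def intro: order_trans)
    moreover have "prob (\<Union>K. B K) = 1"
    proof (subst prob_eq_1)
      show "AE x in M. x \<in> (\<Union>K. B K)"
        using fin AE_space
      proof eventually_elim
        case (elim x)
        then obtain r where r: "\<Phi> x = ennreal r" by (cases "\<Phi> x") auto
        obtain K :: nat where "r \<le> real K" using real_arch_simple by blast
        then have "\<Phi> x \<le> of_nat K" unfolding r ennreal_of_nat_eq_real_of_nat by (rule ennreal_leI)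
        then show ?case using elim by (auto simp: B_def)
      qed
    qed auto
    \<comment> \<open>The event must not depend on the radius, since Tonelli is applied to its
      indicator afterwards; one \<open>K\<close> is therefore fixed for all
      \<open>s\<close>.\<close>
    ultimately have "eventually (\<lambda>K. 1 - pz_const / 2 < prob (B K)) sequentially"
      using pz_const_pos by (intro order_tendstoD(1)) auto
    then obtain K where K: "1 - pz_const / 2 \<le> prob (B K)"
      by (auto simp: eventually_sequentially intro: less_imp_le)
    define C where "C = (1 / 2) powr (q / 2) * (pz_const / 4) powr (q / p) * (pz_const / 4)"
    have "0 < C" using pz_const_pos by (simp add: C_def)
    have "ennreal C * (\<integral>\<^sup>+ s. ennreal (V s) * radial_density c s \<partial>lborel)
        = (\<integral>\<^sup>+ s. ennreal C * (ennreal (V s) * radial_density c s) \<partial>lborel)"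
      by (rule nn_integral_cmult[symmetric]) measurable
    also have "\<dots>
        \<le> (\<integral>\<^sup>+ s. (\<integral>\<^sup>+ x. indicator (B K) x * random_circle_norm a w c p q s x \<partial>M) * radial_density c s \<partial>lborel)"
    proof (rule nn_integral_mono_AE, use c_finite in eventually_elim)
      case (elim s)
      show ?case
      proof (cases "0 < s \<and> s < 1 \<and> c s \<noteq> 0")
        case True
        then have "ennreal C * ennreal (V s)
            \<le> (\<integral>\<^sup>+ x. indicator (B K) x * random_circle_norm a w c p q s x \<partial>M)"
          using random_circle_norm_bounds(2)[of s "B K", folded C_def] elim K \<open>0 < C\<close> by (simp add: V_def less_top flip: ennreal_mult)
        then show ?thesis by (simp add: mult_right_mono flip: mult.assoc)
      qed (auto simp: radial_density_def)
    qed
    also have "\<dots>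
        = (\<integral>\<^sup>+ s. \<integral>\<^sup>+ x. indicator (B K) x * (random_circle_norm a w c p q s x * radial_density c s) \<partial>M \<partial>lborel)"
      by (simp add: nn_integral_multc flip: mult.assoc)
    also have "\<dots>
        = (\<integral>\<^sup>+ x. \<integral>\<^sup>+ s. indicator (B K) x * (random_circle_norm a w c p q s x * radial_density c s) \<partial>lborel \<partial>M)"
      by (rule LM.Fubini'[symmetric]) (auto simp: split_beta')
    also have "\<dots> = (\<integral>\<^sup>+ x. indicator (B K) x * \<Phi> x \<partial>M)"
    proof (rule nn_integral_cong)
      fix x assume [measurable]: "x \<in> space M"
      have "(\<lambda>s. random_circle_norm a w c p q s x) \<in> borel_measurable lborel"
        using measurable_Pair1[OF measurable_random_circle_norm, of x] by simp
      then show "(\<integral>\<^sup>+ s. indicator (B K) x * (random_circle_norm a w c p q s x * radial_density c s) \<partial>lborel)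
          = indicator (B K) x * \<Phi> x"
        unfolding \<Phi>_def by (intro nn_integral_cmult) auto
    qed
    also have "\<dots> \<le> (\<integral>\<^sup>+ x. of_nat K \<partial>M)"
      by (intro nn_integral_mono) (auto simp: B_def split: split_indicator)
    also have "\<dots> < \<infinity>" by (simp add: emeasure_space_1 of_nat_less_top)
    finally show "(\<integral>\<^sup>+ s. ennreal (V s) * radial_density c s \<partial>lborel) < \<infinity>"
      using \<open>0 < C\<close> by (auto simp: ennreal_mult_less_top ennreal_eq_0_iff)
  }
qed

end

text \<open>Convergence of a power series at one point implies convergence at all points of smaller
  modulus, so countably many radii increasing to 1 are enough, and their null sets can be
  united.\<close>

lemma AE_random_series_converges:
  assumes a: "\<And>s. 0 < s \<Longrightarrow> s < 1 \<Longrightarrow> summable (\<lambda>n. cmod (a n) * s ^ n)"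
  shows "AE x in M. \<forall>z\<in>ball 0 1. summable (\<lambda>n. a n * X n x * z ^ n)"
proof -
  \<comment> \<open>The shift by 2 makes the radii start at 1/2, hence lie strictly between 0 and
    1.\<close>
  have "AE x in M. summable (\<lambda>n. a n * of_real (1 - 1 / real (k + 2)) ^ n * X n x)" for k :: nat
    using a[of "1 - 1 / real (k + 2)"]
    by (intro AE_summable) (auto simp: norm_mult norm_power simp del: of_nat_add of_real_diff)
  then have "AE x in M. \<forall>k::nat. summable (\<lambda>n. a n * of_real (1 - 1 / real (k + 2)) ^ n * X n x)"
    by (simp add: AE_all_countable)
  then show ?thesis
  proof eventually_elim
    case (elim x)
    show ?case
    proof
      fix z :: complex assume "z \<in> ball 0 1"
      then have "0 < 1 - cmod z" by simp
      then obtain k :: nat where k: "1 / (1 - cmod z) < real k" using reals_Archimedean2 by blast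
      then have "1 / (1 - cmod z) < real (k + 2)" by simp
      then have "1 / real (k + 2) < 1 - cmod z" using \<open>0 < 1 - cmod z\<close> by (simp add: field_simps)
      moreover have "summable (\<lambda>n. (a n * X n x) * of_real (1 - 1 / real (k + 2)) ^ n)"
        using elim by (simp add: mult_ac)
      ultimately show "summable (\<lambda>n. a n * X n x * z ^ n)"
        by (intro powser_inside[of "\<lambda>n. a n * X n x" "of_real (1 - 1 / real (k + 2))" z]) (simp_all del: of_real_diff)
    qed
  qed
qed

text \<open>Both memberships are translated into integrals against the same Borel density: the
  random one into \<open>\<Phi> x < \<infinity>\<close> for almost every \<open>x\<close>, the
  deterministic one by Parseval. The almost sure criterion then compares the two.\<close>

theorem random_symbol_space_nonradial_mixed_norm_space:
  assumes pos: "0 < p" "0 < q" and \<omega>: "weight \<omega>" and mass: "(\<integral>\<^sup>+ z. ennreal (\<omega> z) \<partial>disc_area) < \<infinity>"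
  shows "random_symbol_space M X (nonradial_mixed_norm_space p q \<omega>)
      = mixed_norm_space 2 q (radial_measure \<omega>)"
proof -
  obtain w where w [measurable]: "w \<in> borel_measurable borel"
    and w_eq: "AE z in lborel. z \<in> ball 0 1 \<longrightarrow> w z = \<omega> z"
    using weight_borel_version[OF \<omega>] by blast
  define c where "c s = (\<integral>\<^sup>+ \<theta>. ennreal (w (of_real s * cis \<theta>)) \<partial>angle_measure)" for s
  interpret angle: prob_space angle_measure by (rule prob_space_angle_measure)
  have [measurable]: "c \<in> borel_measurable borel" unfolding c_def[abs_def] by measurable
  have "ennreal (1 / pi) * (\<integral>\<^sup>+ z. ennreal (w z) * indicator (ball 0 1) z \<partial>lborel)
      = ennreal (1 / pi) * (\<integral>\<^sup>+ z. ennreal (\<omega> z) \<partial>lebesgue_on (ball 0 1))"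
    by (subst nn_integral_lebesgue_on, simp, intro arg_cong2[where f = "(*)"] refl nn_integral_cong_AE)
      (use w_eq in \<open>eventually_elim, auto split: split_indicator\<close>)
  also have "\<dots> < \<infinity>"
    using mass \<omega> unfolding disc_area_def weight_def by (subst (asm) nn_integral_scale_measure) auto
  finally have "(\<integral>\<^sup>+ z. ennreal (w z) * indicator (ball 0 1) z \<partial>lborel) < \<infinity>"
    by (auto simp: ennreal_mult_less_top)
  then have fin: "AE s in lborel. 0 < s \<longrightarrow> s < 1 \<longrightarrow> (\<integral>\<^sup>+ \<theta>. ennreal (w (of_real s * cis \<theta>)) * indicator {0..2 * pi} \<theta> \<partial>lborel) < \<infinity>"
    by (intro AE_circle_finite) auto
  have c_finite: "AE s in lborel. 0 < s \<longrightarrow> s < 1 \<longrightarrow> c s < \<infinity>"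
    using fin by eventually_elim
      (auto simp: c_def nn_integral_angle_measure ennreal_divide_eq_top_iff less_top[symmetric])
  note decomp = circular_decomposition[OF w w_eq c_def]
  have cm: "AE s in lborel. 0 < s \<longrightarrow> s < 1 \<longrightarrow> circular_mean \<omega> s = c s"
    using decomp by (auto elim!: eventually_mono)
  have "f \<in> random_symbol_space M X (nonradial_mixed_norm_space p q \<omega>)
      \<longleftrightarrow> f \<in> mixed_norm_space 2 q (radial_measure \<omega>)"
    if f: "f holomorphic_on ball 0 1" for f
  proof -
    define a where "a = taylor_coeff f"
    have a: "summable (\<lambda>n. cmod (a n) * s ^ n)" if "0 < s" "s < 1" for s
      using summable_taylor_coeff[OF f that] by (simp add: a_def)
    have conv: "AE x in M. \<forall>z\<in>ball 0 1. summable (\<lambda>n. a n * X n x * z ^ n)"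
      by (rule AE_random_series_converges) (rule a)
    define F where "F x z = (\<Sum>n. a n * X n x * z ^ n)" for x z
    define \<Phi> where "\<Phi> x = (\<integral>\<^sup>+ s. random_circle_norm a w c p q s x * radial_density c s \<partial>lborel)" for x
    have norm_F: "(\<integral>\<^sup>+ s. ennreal_powr (\<integral>\<^sup>+ \<theta>. ennreal (cmod (F x (of_real s * cis \<theta>)) powr p) \<partial>circular_measure \<omega> s) (q / p) \<partial>radial_measure \<omega>) = \<Phi> x"
      if [measurable]: "x \<in> space M" for x
      unfolding \<Phi>_def radial_density_def
    proof (rule nn_integral_radial_measure[OF _ _ cm])
      have mF: "(\<lambda>\<theta>. ennreal (cmod (F x (of_real s * cis \<theta>)) powr p)) \<in> borel_measurable borel" for s
        unfolding F_def by measurable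
      show "(\<lambda>s. random_circle_norm a w c p q s x) \<in> borel_measurable borel"
        unfolding random_circle_norm_def by measurable
      show "AE s in lborel. 0 < s \<longrightarrow> s < 1 \<longrightarrow> c s \<noteq> 0 \<longrightarrow>
          ennreal_powr (\<integral>\<^sup>+ \<theta>. ennreal (cmod (F x (of_real s * cis \<theta>)) powr p) \<partial>circular_measure \<omega> s) (q / p) = random_circle_norm a w c p q s x"
        using decomp
      proof eventually_elim
        case (elim s)
        then show ?case using mF[of s] by (auto simp: random_circle_norm_def F_def mult_ac)
      qed
    qed measurable
    have "f \<in> random_symbol_space M X (nonradial_mixed_norm_space p q \<omega>) \<longleftrightarrow> (AE x in M. \<Phi> x < \<infinity>)"
    proof -
      \<comment> \<open>Almost surely the random series converges in the disc and is thus
        holomorphic there, so off a null set membership in the space amounts to a finite norm. An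
        equivalence that holds almost everywhere carries over to the two \<open>AE\<close>
        statements.\<close>
      have "AE x in M. ((\<forall>z\<in>ball 0 1. summable (\<lambda>n. a n * X n x * z ^ n)) \<and> F x \<in> nonradial_mixed_norm_space p q \<omega>)
          \<longleftrightarrow> \<Phi> x < \<infinity>"
        using conv AE_space
      proof eventually_elim
        case (elim x)
        have "F x holomorphic_on ball 0 1"
          by (rule power_series_holomorphic[where a = "\<lambda>n. a n * X n x"])
            (use elim in \<open>auto simp: F_def intro: summable_sums\<close>)
        then show ?case using elim norm_F by (simp add: nonradial_mixed_norm_space_def)
      qed
      then have "(AE x in M. (\<forall>z\<in>ball 0 1. summable (\<lambda>n. a n * X n x * z ^ n)) \<and> F x \<in> nonradial_mixed_norm_space p q \<omega>)
          \<longleftrightarrow> (AE x in M. \<Phi> x < \<infinity>)"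
        by (auto elim!: eventually_elim2)
      then show ?thesis using f by (simp add: random_symbol_space_def F_def[abs_def] a_def)
    qed
    also have "\<dots>
        \<longleftrightarrow> (\<integral>\<^sup>+ s. ennreal ((\<Sum>n. (cmod (a n) * s ^ n)\<^sup>2) powr (q / 2)) * radial_density c s \<partial>lborel) < \<infinity>"
      unfolding \<Phi>_def by (rule AE_random_mixed_norm_finite_iff[OF pos a w c_def c_finite])
    also have "\<dots> \<longleftrightarrow> (\<integral>\<^sup>+ s. ennreal_powr (integral_mean 2 f s) q \<partial>radial_measure \<omega>) < \<infinity>"
      unfolding radial_density_def
      by (subst nn_integral_radial_measure[OF _ _ cm])
        (auto simp: integral_mean_2[OF f] ennreal_powr_ennreal powr_powr a_def)
    also have "\<dots> \<longleftrightarrow> f \<in> mixed_norm_space 2 q (radial_measure \<omega>)"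
      using f by (simp add: mixed_norm_space_def)
    finally show ?thesis .
  qed
  then show ?thesis by (auto simp: random_symbol_space_def mixed_norm_space_def)
qed

end

theorem theorem1p8:
  fixes p q :: real
    and \<omega> :: "complex \<Rightarrow> real"
    and M :: "'a measure"
    and X :: "nat \<Rightarrow> 'a \<Rightarrow> complex"
  assumes "0 < p" and "0 < q"
    and "admissible_weight p \<omega>"
    and "prob_space M"
    and "standard_random_sequence M X"
  shows "random_symbol_space M X (nonradial_mixed_norm_space p q \<omega>)
       = mixed_norm_space 2 q (radial_measure \<omega>)"
proof -
  interpret subgaussian_sequence M X
    using assms by (intro standard_random_sequence_subgaussian)
  show ?thesis
    using assms by (intro random_symbol_space_nonradial_mixed_norm_space)
      (auto simp: admissible_weight_def)
qed

end
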